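(* Let $\kappa$ be a perfect kernel on a locally compact Hausdorff space $\mathrm X$, let $\nu\in\mathcal E$, and let $F\subset\mathrm X$ be closed with $C(F)>0$. Let $K$ range over the compact subsets of $F$ with $C(K)>0$, ordered by inclusion (an increasing filtering family, cofinal among all compact subsets of $F$). Then $P_K\nu\to P_F\nu$ both strongly and vaguely as $K\uparrow F$.
   Context: A kernel is a lower semicontinuous $\kappa:\mathrm X\times\mathrm X\to(-\infty,\infty]$, nonnegative unless $\mathrm X\times\mathrm X$ is compact. Mutual energy $\kappa(\nu,\nu_1)=\int\kappa\,d(\nu\otimes\nu_1)$; $\mathcal E$ is the set of real Radon measures $\nu$ with $\kappa(\nu,\nu)$ well defined and finite. $\kappa$ is perfect if it is symmetric, strictly positive definite ($\kappa(\nu,\nu)\ge0$ whenever defined and $\|\nu\|:=\kappa(\nu,\nu)^{1/2}$ is a norm on the pre-Hilbert space $\mathcal E$, whose topology is called strong), and consistent: every strong Cauchy net in $\mathcal E^+=\{\nu\in\mathcal E:\nu\ge0\}$ converges strongly to each of its vague cluster points. $\mathcal E^+_E$ is the set of elements of $\mathcal E^+$ concentrated on $E$; interior capacity $C(E)=1/\inf\{\kappa(\mu,\mu):\mu\in\mathcal E^+_E,\mu(E)=1\}$. For closed $F$ with $C(F)>0$ and $\nu\in\mathcal E$, $P_F\nu$ denotes the (unique) orthogonal projection of $\nu$ onto the convex cone $\mathcal E^+_F$, i.e. the $\omega\in\mathcal E^+_F$ minimizing $\|\nu-\omega\|$. *)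

theory Defs
  imports "HOL-Analysis.Analysis"
begin

text \<open>Real Radon measures on a locally compact Hausdorff space are represented
(Bourbaki style) as real linear functionals on the space of continuous functions
with compact support; the functional is normalised to be 0 outside that space.\<close>

type_synonym 'a rmeas = "('a \<Rightarrow> real) \<Rightarrow> real"

definition Cc :: "('a::topological_space \<Rightarrow> real) set" where
  "Cc = {f. continuous_on UNIV f \<and> compact (closure {x. f x \<noteq> 0})}"

definition tsupp :: "('a::topological_space \<Rightarrow> real) \<Rightarrow> 'a set" where
  "tsupp f = closure {x. f x \<noteq> 0}"

definition real_radon :: "'a::topological_space rmeas \<Rightarrow> bool" where
  "real_radon \<nu> \<longleftrightarrow>
     (\<forall>f. f \<notin> Cc \<longrightarrow> \<nu> f = 0) \<and>
     (\<forall>f\<in>Cc. \<forall>g\<in>Cc. \<nu> (\<lambda>x. f x + g x) = \<nu> f + \<nu> g) \<and>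
     (\<forall>f\<in>Cc. \<forall>c. \<nu> (\<lambda>x. c * f x) = c * \<nu> f) \<and>
     (\<forall>K. compact K \<longrightarrow> (\<exists>M. \<forall>f\<in>Cc. tsupp f \<subseteq> K \<longrightarrow> \<bar>\<nu> f\<bar> \<le> M * (SUP x. \<bar>f x\<bar>)))"

definition positive_rm :: "'a::topological_space rmeas \<Rightarrow> bool" where
  "positive_rm \<nu> \<longleftrightarrow> (\<forall>f\<in>Cc. (\<forall>x. 0 \<le> f x) \<longrightarrow> 0 \<le> \<nu> f)"

definition pos_part_nonneg :: "'a::topological_space rmeas \<Rightarrow> ('a \<Rightarrow> real) \<Rightarrow> real" where
  "pos_part_nonneg lam f = Sup {lam g | g. g \<in> Cc \<and> (\<forall>x. 0 \<le> g x \<and> g x \<le> f x)}"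

definition pos_part :: "'a::topological_space rmeas \<Rightarrow> 'a rmeas" where
  "pos_part lam f = (if f \<in> Cc then pos_part_nonneg lam (\<lambda>x. max (f x) 0)
                                  - pos_part_nonneg lam (\<lambda>x. max (- f x) 0) else 0)"

definition neg_part :: "'a::topological_space rmeas \<Rightarrow> 'a rmeas" where
  "neg_part lam = pos_part (- lam)"

definition tensor :: "'a::topological_space rmeas \<Rightarrow> 'a rmeas \<Rightarrow> ('a \<times> 'a) rmeas" where
  "tensor \<nu> \<nu>1 f = (if f \<in> Cc then \<nu> (\<lambda>x. \<nu>1 (\<lambda>y. f (x, y))) else 0)"

text \<open>Integral of a lower semicontinuous function (bounded below on compacts)
w.r.t. a positive Radon measure (Bourbaki's upper integral).\<close>

definition lsc_integral :: "'b::topological_space rmeas \<Rightarrow> ('b \<Rightarrow> ereal) \<Rightarrow> ereal" where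
  "lsc_integral lam h = (SUP f\<in>{f\<in>Cc. \<forall>z. ereal (f z) \<le> h z}. ereal (lam f))"

definition kernel :: "('a::topological_space \<Rightarrow> 'a \<Rightarrow> ereal) \<Rightarrow> bool" where
  "kernel \<kappa> \<longleftrightarrow> (\<forall>x y. \<kappa> x y \<noteq> -\<infinity>) \<and>
     (\<forall>c::real. open {z::'a\<times>'a. ereal c < \<kappa> (fst z) (snd z)}) \<and>
     (\<not> compact (UNIV :: ('a \<times> 'a) set) \<longrightarrow> (\<forall>x y. 0 \<le> \<kappa> x y))"

definition energy_pos :: "('a::topological_space \<Rightarrow> 'a \<Rightarrow> ereal) \<Rightarrow> 'a rmeas \<Rightarrow> 'a rmeas \<Rightarrow> ereal" where
  "energy_pos \<kappa> \<nu> \<nu>1 = lsc_integral (pos_part (tensor \<nu> \<nu>1)) (\<lambda>z. \<kappa> (fst z) (snd z))"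

definition energy_neg :: "('a::topological_space \<Rightarrow> 'a \<Rightarrow> ereal) \<Rightarrow> 'a rmeas \<Rightarrow> 'a rmeas \<Rightarrow> ereal" where
  "energy_neg \<kappa> \<nu> \<nu>1 = lsc_integral (neg_part (tensor \<nu> \<nu>1)) (\<lambda>z. \<kappa> (fst z) (snd z))"

definition energy_defined :: "('a::topological_space \<Rightarrow> 'a \<Rightarrow> ereal) \<Rightarrow> 'a rmeas \<Rightarrow> 'a rmeas \<Rightarrow> bool" where
  "energy_defined \<kappa> \<nu> \<nu>1 \<longleftrightarrow> \<not> (energy_pos \<kappa> \<nu> \<nu>1 = \<infinity> \<and> energy_neg \<kappa> \<nu> \<nu>1 = \<infinity>)"

definition energy :: "('a::topological_space \<Rightarrow> 'a \<Rightarrow> ereal) \<Rightarrow> 'a rmeas \<Rightarrow> 'a rmeas \<Rightarrow> ereal" where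
  "energy \<kappa> \<nu> \<nu>1 = energy_pos \<kappa> \<nu> \<nu>1 - energy_neg \<kappa> \<nu> \<nu>1"

definition Emeas :: "('a::topological_space \<Rightarrow> 'a \<Rightarrow> ereal) \<Rightarrow> 'a rmeas set" where
  "Emeas \<kappa> = {\<nu>. real_radon \<nu> \<and> energy_defined \<kappa> \<nu> \<nu> \<and> \<bar>energy \<kappa> \<nu> \<nu>\<bar> \<noteq> \<infinity>}"

definition Emeas_pos :: "('a::topological_space \<Rightarrow> 'a \<Rightarrow> ereal) \<Rightarrow> 'a rmeas set" where
  "Emeas_pos \<kappa> = {\<nu>\<in>Emeas \<kappa>. positive_rm \<nu>}"

definition enorm :: "('a::topological_space \<Rightarrow> 'a \<Rightarrow> ereal) \<Rightarrow> 'a rmeas \<Rightarrow> real" where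
  "enorm \<kappa> \<nu> = sqrt (real_of_ereal (energy \<kappa> \<nu> \<nu>))"

definition strong_tendsto :: "('a::topological_space \<Rightarrow> 'a \<Rightarrow> ereal) \<Rightarrow> ('i \<Rightarrow> 'a rmeas) \<Rightarrow> 'a rmeas \<Rightarrow> 'i filter \<Rightarrow> bool" where
  "strong_tendsto \<kappa> g \<omega> F \<longleftrightarrow> \<omega> \<in> Emeas \<kappa> \<and> eventually (\<lambda>i. g i \<in> Emeas \<kappa>) F \<and>
      ((\<lambda>i. enorm \<kappa> (g i - \<omega>)) \<longlongrightarrow> 0) F"

definition strong_cauchy :: "('a::topological_space \<Rightarrow> 'a \<Rightarrow> ereal) \<Rightarrow> ('i \<Rightarrow> 'a rmeas) \<Rightarrow> 'i filter \<Rightarrow> bool" where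
  "strong_cauchy \<kappa> g F \<longleftrightarrow> eventually (\<lambda>i. g i \<in> Emeas \<kappa>) F \<and>
      (\<forall>e>0. eventually (\<lambda>(i, j). enorm \<kappa> (g i - g j) < e) (F \<times>\<^sub>F F))"

definition vague_tendsto :: "('i \<Rightarrow> 'a::topological_space rmeas) \<Rightarrow> 'a rmeas \<Rightarrow> 'i filter \<Rightarrow> bool" where
  "vague_tendsto g \<omega> F \<longleftrightarrow> (\<forall>f\<in>Cc. ((\<lambda>i. g i f) \<longlongrightarrow> \<omega> f) F)"

definition vague_cluster :: "('i \<Rightarrow> 'a::topological_space rmeas) \<Rightarrow> 'a rmeas \<Rightarrow> 'i filter \<Rightarrow> bool" where
  "vague_cluster g \<omega> F \<longleftrightarrow> real_radon \<omega> \<and>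
     (\<forall>fs e. finite fs \<and> fs \<subseteq> Cc \<and> e > 0 \<longrightarrow>
        frequently (\<lambda>i. \<forall>f\<in>fs. \<bar>g i f - \<omega> f\<bar> < e) F)"

definition perfect_kernel :: "('a::topological_space \<Rightarrow> 'a \<Rightarrow> ereal) \<Rightarrow> bool" where
  "perfect_kernel \<kappa> \<longleftrightarrow> kernel \<kappa> \<and>
     (\<forall>x y. \<kappa> x y = \<kappa> y x) \<and>
     (\<forall>\<nu>. real_radon \<nu> \<and> energy_defined \<kappa> \<nu> \<nu> \<longrightarrow> 0 \<le> energy \<kappa> \<nu> \<nu>) \<and>
     (\<forall>\<nu>\<in>Emeas \<kappa>. energy \<kappa> \<nu> \<nu> = 0 \<longrightarrow> \<nu> = (\<lambda>f. 0)) \<and>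
     (\<forall>F :: 'a rmeas filter. F \<noteq> bot \<and> eventually (\<lambda>\<nu>. \<nu> \<in> Emeas_pos \<kappa>) F \<and>
        strong_cauchy \<kappa> id F \<longrightarrow>
        (\<forall>\<omega>. vague_cluster id \<omega> F \<longrightarrow> strong_tendsto \<kappa> id \<omega> F))"

text \<open>\<open>\<nu>\<close> is concentrated on the closed set \<open>F\<close>: \<open>\<nu>(X \<setminus> F) = 0\<close>.\<close>

definition conc_on :: "'a::topological_space rmeas \<Rightarrow> 'a set \<Rightarrow> bool" where
  "conc_on \<nu> F \<longleftrightarrow> (\<forall>f\<in>Cc. tsupp f \<inter> F = {} \<longrightarrow> \<nu> f = 0)"

definition Emeas_pos_on :: "('a::topological_space \<Rightarrow> 'a \<Rightarrow> ereal) \<Rightarrow> 'a set \<Rightarrow> 'a rmeas set" where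
  "Emeas_pos_on \<kappa> F = {\<nu>\<in>Emeas_pos \<kappa>. conc_on \<nu> F}"

text \<open>Total mass of a positive Radon measure (equal to \<open>\<mu>(F)\<close> if \<open>\<mu>\<close> is concentrated on \<open>F\<close>).\<close>

definition total_mass :: "'a::topological_space rmeas \<Rightarrow> ereal" where
  "total_mass \<mu> = (SUP f\<in>{f\<in>Cc. \<forall>x. 0 \<le> f x \<and> f x \<le> 1}. ereal (\<mu> f))"

definition capacity :: "('a::topological_space \<Rightarrow> 'a \<Rightarrow> ereal) \<Rightarrow> 'a set \<Rightarrow> ereal" where
  "capacity \<kappa> F = inverse (INF \<mu>\<in>{\<mu>\<in>Emeas_pos_on \<kappa> F. total_mass \<mu> = 1}. energy \<kappa> \<mu> \<mu>)"

definition proj :: "('a::topological_space \<Rightarrow> 'a \<Rightarrow> ereal) \<Rightarrow> 'a set \<Rightarrow> 'a rmeas \<Rightarrow> 'a rmeas" where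
  "proj \<kappa> F \<nu> = (THE \<omega>. \<omega> \<in> Emeas_pos_on \<kappa> F \<and>
      (\<forall>\<omega>'\<in>Emeas_pos_on \<kappa> F. enorm \<kappa> (\<nu> - \<omega>) \<le> enorm \<kappa> (\<nu> - \<omega>')))"

definition cpt_pos_subsets :: "('a::topological_space \<Rightarrow> 'a \<Rightarrow> ereal) \<Rightarrow> 'a set \<Rightarrow> 'a set set" where
  "cpt_pos_subsets \<kappa> F = {K. compact K \<and> K \<subseteq> F \<and> capacity \<kappa> K > 0}"

definition K_up :: "('a::topological_space \<Rightarrow> 'a \<Rightarrow> ereal) \<Rightarrow> 'a set \<Rightarrow> 'a set filter" where
  "K_up \<kappa> F = (INF K\<in>cpt_pos_subsets \<kappa> F. principal {K'\<in>cpt_pos_subsets \<kappa> F. K \<subseteq> K'})"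

end

theory Submission
  imports Defs "HOL-Library.Function_Algebras"
begin

text \<open>
  Every element of \<open>\<E>\<close> is a difference of elements of \<open>\<E>\<^sup>+\<close>, because
  \<open>\<nu>\<^sup>+ \<otimes> \<nu>\<^sup>+\<close> and \<open>\<nu>\<^sup>- \<otimes> \<nu>\<^sup>-\<close> are dominated by \<open>(\<nu> \<otimes> \<nu>)\<^sup>+\<close>; mutual energies of
  \<open>a, b \<in> \<E>\<^sup>+\<close> are finite, since otherwise the energy of \<open>a - b\<close> would be defined and equal to
  \<open>-\<infinity>\<close>. Hence the energy is a quadratic form on \<open>\<E>\<close> and the parallelogram law is available.
  Consistency yields that strongly bounded subsets of \<open>\<E>\<^sup>+\<close> are vaguely bounded, so that a
  minimising sequence for the projection has a vague cluster point, to which it converges strongly.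

  For \<open>\<mu> \<in> \<E>\<^sup>+\<^sub>F\<close> the measures \<open>\<phi>\<mu>\<close> with \<open>\<phi>\<close> continuous of compact support, \<open>0 \<le> \<phi> \<le> 1\<close>, are
  concentrated on compact subsets of \<open>F\<close> and approximate \<open>\<mu>\<close> strongly. Applied to \<open>\<mu> = P\<^sub>F \<nu>\<close>
  this shows that \<open>\<parallel>\<nu> - P\<^sub>K \<nu>\<parallel>\<close> decreases to \<open>\<parallel>\<nu> - P\<^sub>F \<nu>\<parallel>\<close>, and the parallelogram law turns this
  into strong convergence. Vague convergence follows, as every vague cluster point of a strongly
  convergent net in \<open>\<E>\<^sup>+\<close> is its strong limit.
\<close>

section \<open>Functions of compact support and positive functionals\<close>

text \<open>The energy of a signed \<nu> is defined through the Jordan parts of \<nu> \<otimes>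
  \<nu>, not through those of \<nu>, so neither bilinearity nor closure of \<E> under subtraction
  can be read off. For positive measures the mutual energy is a supremum over a fixed family of
  minorants of the kernel that is directed upwards, hence additive, and the signed case is reduced
  to this one.

  That strong bounds imply vague bounds is shown by contradiction. Measures whose norm is small
  compared with their mass on a test function, cut off and normalised to mass 1, would form a
  vaguely bounded, strongly null sequence. Consistency forces its cluster point to be 0, yet some
  test function keeps the value 1.

  Two cases recur. On a noncompact space the kernel is nonnegative, so multiplying a positive
  measure by a function with values in [0, 1] cannot increase its energy. On a compact space the
  kernel may be negative and this fails, but there the constant 1 is a test function and closed sets
  are compact, which replaces cutting off.\<close>

lemma Cc_continuous: "f \<in> Cc \<Longrightarrow> continuous_on UNIV f"
  by (simp add: Cc_def)

lemma Cc_compact_tsupp: "f \<in> Cc \<Longrightarrow> compact (tsupp f)"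
  by (simp add: Cc_def tsupp_def)

lemma closed_tsupp [simp]: "closed (tsupp f)"
  by (simp add: tsupp_def)

lemma eq_0_outside_tsupp: "x \<notin> tsupp f \<Longrightarrow> f x = 0"
  using closure_subset[of "{x. f x \<noteq> 0}"] by (auto simp: tsupp_def)

lemma tsupp_minimal: "closed S \<Longrightarrow> (\<And>x. x \<notin> S \<Longrightarrow> f x = 0) \<Longrightarrow> tsupp f \<subseteq> S"
  unfolding tsupp_def by (rule closure_minimal) auto

lemma CcI:
  assumes "continuous_on UNIV f" "compact S" "closed S" "\<And>x. x \<notin> S \<Longrightarrow> f x = 0"
  shows "f \<in> Cc"
proof -
  have "compact (S \<inter> tsupp f)" using assms by (intro compact_Int_closed) auto
  moreover have "S \<inter> tsupp f = tsupp f" using tsupp_minimal[of S f] assms by auto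
  ultimately show ?thesis using assms(1) by (simp add: Cc_def tsupp_def)
qed

lemma Cc_dominated:
  assumes "continuous_on UNIV f" "g \<in> Cc" "\<And>x. g x = 0 \<Longrightarrow> f x = 0"
  shows "f \<in> Cc"
  using assms by (intro CcI[where S="tsupp g"]) (auto simp: Cc_compact_tsupp eq_0_outside_tsupp)

lemma Cc_dominated2:
  assumes "continuous_on UNIV f" "g \<in> Cc" "h \<in> Cc" "\<And>x. g x = 0 \<Longrightarrow> h x = 0 \<Longrightarrow> f x = 0"
  shows "f \<in> Cc"
  using assms
  by (intro CcI[where S="tsupp g \<union> tsupp h"]) (auto simp: Cc_compact_tsupp eq_0_outside_tsupp)

lemma Cc_zero [simp]: "(\<lambda>x. 0) \<in> Cc"
  by (rule CcI[where S="{}"]) auto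

lemma Cc_add [simp]: "f \<in> Cc \<Longrightarrow> g \<in> Cc \<Longrightarrow> (\<lambda>x. f x + g x) \<in> Cc"
  by (rule Cc_dominated2[where g=f and h=g]) (auto intro!: continuous_intros intro: Cc_continuous)

lemma Cc_diff [simp]: "f \<in> Cc \<Longrightarrow> g \<in> Cc \<Longrightarrow> (\<lambda>x. f x - g x) \<in> Cc"
  by (rule Cc_dominated2[where g=f and h=g]) (auto intro!: continuous_intros intro: Cc_continuous)

lemma Cc_max [simp]: "f \<in> Cc \<Longrightarrow> g \<in> Cc \<Longrightarrow> (\<lambda>x. max (f x) (g x)) \<in> Cc"
  by (rule Cc_dominated2[where g=f and h=g]) (auto intro!: continuous_intros intro: Cc_continuous)

lemma Cc_min [simp]: "f \<in> Cc \<Longrightarrow> g \<in> Cc \<Longrightarrow> (\<lambda>x. min (f x) (g x)) \<in> Cc"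
  by (rule Cc_dominated2[where g=f and h=g]) (auto intro!: continuous_intros intro: Cc_continuous)

lemma Cc_mult_continuous:
  "continuous_on UNIV u \<Longrightarrow> f \<in> Cc \<Longrightarrow> (\<lambda>x. u x * f x) \<in> Cc"
  by (rule Cc_dominated) (auto intro!: continuous_intros dest: Cc_continuous)

lemma Cc_cmult [simp]: "f \<in> Cc \<Longrightarrow> (\<lambda>x. c * f x) \<in> Cc"
  by (rule Cc_mult_continuous) auto

lemma Cc_uminus [simp]: "f \<in> Cc \<Longrightarrow> (\<lambda>x. - f x) \<in> Cc"
  using Cc_cmult[of f "-1"] by simp

lemma Cc_sum: "(\<And>i. i \<in> I \<Longrightarrow> f i \<in> Cc) \<Longrightarrow> (\<lambda>x. \<Sum>i\<in>I. f i x) \<in> Cc"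
  by (induction I rule: infinite_finite_induct) auto

lemma Cc_bounded:
  assumes "f \<in> Cc"
  obtains B where "B > 0" "\<And>x. \<bar>f x\<bar> \<le> B"
proof -
  have "compact (f ` tsupp f)"
    using Cc_continuous[OF assms] Cc_compact_tsupp[OF assms]
    by (intro compact_continuous_image) (auto intro: continuous_on_subset)
  then obtain B where B: "\<And>x. x \<in> tsupp f \<Longrightarrow> \<bar>f x\<bar> \<le> B"
    using compact_imp_bounded bounded_iff by (metis image_eqI real_norm_def)
  have "\<bar>f x\<bar> \<le> max B 1" for x
    using B[of x] eq_0_outside_tsupp[of x f] by (cases "x \<in> tsupp f") auto
  then show ?thesis by (intro that[of "max B 1"]) auto
qed

lemma abs_le_SUP_Cc: "f \<in> Cc \<Longrightarrow> \<bar>f x\<bar> \<le> (SUP x. \<bar>f x\<bar>)"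
  by (elim Cc_bounded) (auto intro!: cSUP_upper bdd_aboveI2)

lemma SUP_abs_le: "(\<And>x. \<bar>f x\<bar> \<le> B) \<Longrightarrow> (SUP x. \<bar>f x\<bar>) \<le> (B::real)"
  by (rule cSUP_least) auto

lemma SUP_abs_Cc_nonneg: "f \<in> Cc \<Longrightarrow> 0 \<le> (SUP x. \<bar>f x\<bar>)"
  using abs_le_SUP_Cc[of f undefined] by linarith

text \<open>\<open>real_radon\<close> without the local bound. Tensor products and their Jordan
  parts, which live on the product space, are handled at this level.\<close>

definition linear_rm :: "'b::topological_space rmeas \<Rightarrow> bool" where
  "linear_rm lam \<longleftrightarrow> (\<forall>f. f \<notin> Cc \<longrightarrow> lam f = 0) \<and>
     (\<forall>f\<in>Cc. \<forall>g\<in>Cc. lam (\<lambda>x. f x + g x) = lam f + lam g) \<and>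
     (\<forall>f\<in>Cc. \<forall>c. lam (\<lambda>x. c * f x) = c * lam f)"

definition poslin_rm :: "'b::topological_space rmeas \<Rightarrow> bool" where
  "poslin_rm lam \<longleftrightarrow> linear_rm lam \<and> positive_rm lam"

text \<open>This is what gives meaning to the real \<open>Sup\<close> in
  \<open>pos_part_nonneg\<close>, which says nothing about unbounded sets.\<close>

definition order_bounded_rm :: "'b::topological_space rmeas \<Rightarrow> bool" where
  "order_bounded_rm lam \<longleftrightarrow>
     (\<forall>f\<in>Cc. bdd_above {lam g | g. g \<in> Cc \<and> (\<forall>x. 0 \<le> g x \<and> g x \<le> f x)})"

lemma linear_rm_outside: "linear_rm lam \<Longrightarrow> f \<notin> Cc \<Longrightarrow> lam f = 0"
  and linear_rm_add: "linear_rm lam \<Longrightarrow> f \<in> Cc \<Longrightarrow> g \<in> Cc \<Longrightarrow> lam (\<lambda>x. f x + g x) = lam f + lam g"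
  and linear_rm_cmult: "linear_rm lam \<Longrightarrow> f \<in> Cc \<Longrightarrow> lam (\<lambda>x. c * f x) = c * lam f"
  by (auto simp: linear_rm_def)

lemma linear_rm_uminus: "linear_rm lam \<Longrightarrow> f \<in> Cc \<Longrightarrow> lam (\<lambda>x. - f x) = - lam f"
  using linear_rm_cmult[of lam f "-1"] by simp

lemma linear_rm_diff:
  "linear_rm lam \<Longrightarrow> f \<in> Cc \<Longrightarrow> g \<in> Cc \<Longrightarrow> lam (\<lambda>x. f x - g x) = lam f - lam g"
  using linear_rm_add[of lam f "\<lambda>x. - g x"] linear_rm_uminus[of lam g] by auto

lemma linear_rm_zero: "linear_rm lam \<Longrightarrow> lam (\<lambda>x. 0) = 0"
  using linear_rm_cmult[of lam "\<lambda>x. 0" 0] by simp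

lemma linear_rm_sum:
  assumes "linear_rm lam" "finite I" "\<And>i. i \<in> I \<Longrightarrow> f i \<in> Cc"
  shows "lam (\<lambda>x. \<Sum>i\<in>I. c i * f i x) = (\<Sum>i\<in>I. c i * lam (f i))"
  using assms(2,3)
proof (induction I rule: finite_induct)
  case empty
  then show ?case using linear_rm_zero[OF assms(1)] by simp
next
  case (insert i I)
  have "(\<lambda>x. \<Sum>i\<in>I. c i * f i x) \<in> Cc" using insert by (intro Cc_sum) auto
  then show ?case using insert
    by (simp add: linear_rm_add[OF assms(1)] linear_rm_cmult[OF assms(1)] Cc_cmult)
qed

lemma linear_rm_plus: "linear_rm a \<Longrightarrow> linear_rm b \<Longrightarrow> linear_rm (a + b)"
  and linear_rm_minus: "linear_rm a \<Longrightarrow> linear_rm b \<Longrightarrow> linear_rm (a - b)"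
  and linear_rm_scale: "linear_rm a \<Longrightarrow> linear_rm (\<lambda>f. c * a f)"
  and linear_rm_neg: "linear_rm a \<Longrightarrow> linear_rm (- a)"
  by (auto simp: linear_rm_def algebra_simps)

lemma poslin_rmD: "poslin_rm a \<Longrightarrow> linear_rm a"
  by (simp add: poslin_rm_def)

lemma poslin_rm_nonneg: "poslin_rm a \<Longrightarrow> (\<And>x. 0 \<le> f x) \<Longrightarrow> 0 \<le> a f"
  by (cases "f \<in> Cc") (auto simp: poslin_rm_def positive_rm_def linear_rm_def)

lemma poslin_rm_mono:
  assumes "poslin_rm a" "f \<in> Cc" "g \<in> Cc" "\<And>x. f x \<le> g x"
  shows "a f \<le> a g"
  using poslin_rm_nonneg[OF assms(1), of "\<lambda>x. g x - f x"] assms(4)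
    linear_rm_diff[OF poslin_rmD[OF assms(1)] assms(3,2)]
  by simp

lemma poslin_rm_abs:
  assumes "poslin_rm a" "f \<in> Cc" "g \<in> Cc" "\<And>x. \<bar>f x\<bar> \<le> g x"
  shows "\<bar>a f\<bar> \<le> a g"
proof -
  have "f x \<le> g x" "- f x \<le> g x" for x using assms(4)[of x] by auto
  then have "a f \<le> a g" "a (\<lambda>x. - f x) \<le> a g"
    using assms(2,3) by (auto intro!: poslin_rm_mono[OF assms(1)])
  then show ?thesis using linear_rm_uminus[OF poslin_rmD[OF assms(1)] assms(2)] by simp
qed

lemma poslin_rm_plus: "poslin_rm a \<Longrightarrow> poslin_rm b \<Longrightarrow> poslin_rm (a + b)"
  by (auto simp: poslin_rm_def linear_rm_plus positive_rm_def)

lemma poslin_rm_scale: "poslin_rm a \<Longrightarrow> 0 \<le> c \<Longrightarrow> poslin_rm (\<lambda>f. c * a f)"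
  by (auto simp: poslin_rm_def linear_rm_scale positive_rm_def)

lemma poslin_rm_zero: "poslin_rm (\<lambda>f. 0)"
  by (auto simp: poslin_rm_def linear_rm_def positive_rm_def)

lemma poslin_rm_minus:
  assumes "linear_rm a" "linear_rm b" "\<And>f. f \<in> Cc \<Longrightarrow> (\<And>x. 0 \<le> f x) \<Longrightarrow> b f \<le> a f"
  shows "poslin_rm (a - b)"
  using assms by (auto simp: poslin_rm_def linear_rm_minus positive_rm_def)

section \<open>Jordan decomposition of order bounded functionals\<close>

context
  fixes lam :: "'b::topological_space rmeas"
  assumes lin: "linear_rm lam" and bdd: "order_bounded_rm lam"
begin

private lemma ppn_bdd:
  "f \<in> Cc \<Longrightarrow> bdd_above {lam g | g. g \<in> Cc \<and> (\<forall>x. 0 \<le> g x \<and> g x \<le> f x)}"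
  using bdd by (auto simp: order_bounded_rm_def)

lemma pos_part_nonneg_upper:
  assumes "f \<in> Cc" "g \<in> Cc" "\<And>x. 0 \<le> g x" "\<And>x. g x \<le> f x"
  shows "lam g \<le> pos_part_nonneg lam f"
  unfolding pos_part_nonneg_def using assms ppn_bdd[OF assms(1)] by (intro cSup_upper) auto

lemma pos_part_nonneg_least:
  assumes "\<And>x. 0 \<le> f x" "\<And>g. g \<in> Cc \<Longrightarrow> (\<And>x. 0 \<le> g x) \<Longrightarrow> (\<And>x. g x \<le> f x) \<Longrightarrow> lam g \<le> B"
  shows "pos_part_nonneg lam f \<le> B"
  unfolding pos_part_nonneg_def
proof (rule cSup_least)
  show "{lam g |g. g \<in> Cc \<and> (\<forall>x. 0 \<le> g x \<and> g x \<le> f x)} \<noteq> {}"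
    using assms(1) Cc_zero by blast
qed (use assms in auto)

private lemma ppn_ge0:
  assumes "f \<in> Cc" "\<And>x. 0 \<le> f x"
  shows "0 \<le> pos_part_nonneg lam f"
  using pos_part_nonneg_upper[OF assms(1), of "\<lambda>x. 0"] assms linear_rm_zero[OF lin] by auto

text \<open>Riesz decomposition: a function \<open>h\<close> between 0 and \<open>f + g\<close>
  splits into \<open>min h f\<close>, which lies below \<open>f\<close>, and a remainder below
  \<open>g\<close>. For the converse, the supremum over \<open>u\<close> is taken at fixed
  \<open>v\<close>.\<close>

private lemma ppn_add:
  assumes f: "f \<in> Cc" "\<And>x. 0 \<le> f x" and g: "g \<in> Cc" "\<And>x. 0 \<le> g x"
  shows "pos_part_nonneg lam (\<lambda>x. f x + g x) = pos_part_nonneg lam f + pos_part_nonneg lam g"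
    (is "?P (\<lambda>x. f x + g x) = _")
proof (rule antisym)
  show "?P (\<lambda>x. f x + g x) \<le> ?P f + ?P g"
  proof (rule pos_part_nonneg_least)
    fix h assume h: "h \<in> Cc" "\<And>x. 0 \<le> h x" "\<And>x. h x \<le> f x + g x"
    let ?h1 = "\<lambda>x. min (h x) (f x)"
    let ?h2 = "\<lambda>x. h x - ?h1 x"
    have c: "?h1 \<in> Cc" "?h2 \<in> Cc" using h f by auto
    have "lam h = lam (\<lambda>x. ?h1 x + ?h2 x)" by simp
    also have "\<dots> = lam ?h1 + lam ?h2" using linear_rm_add[OF lin c] .
    also have "lam ?h1 \<le> ?P f" using h f c by (intro pos_part_nonneg_upper) auto
    also have "lam ?h2 \<le> ?P g"
    proof (rule pos_part_nonneg_upper[OF g(1) c(2)])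
      fix x show "0 \<le> ?h2 x" "?h2 x \<le> g x" using h(3)[of x] g(2)[of x] by auto
    qed
    finally show "lam h \<le> ?P f + ?P g" by simp
  qed (use f g in auto)
  have "?P f \<le> ?P (\<lambda>x. f x + g x) - lam v" if v: "v \<in> Cc" "\<And>x. 0 \<le> v x" "\<And>x. v x \<le> g x" for v
  proof (rule pos_part_nonneg_least[OF f(2)])
    fix u assume u: "u \<in> Cc" "\<And>x. 0 \<le> u x" "\<And>x. u x \<le> f x"
    have "lam (\<lambda>x. u x + v x) \<le> ?P (\<lambda>x. f x + g x)"
      using u v f g by (intro pos_part_nonneg_upper) (auto intro: add_mono)
    then show "lam u \<le> ?P (\<lambda>x. f x + g x) - lam v"
      using linear_rm_add[OF lin u(1) v(1)] by simp
  qed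
  then have "?P g \<le> ?P (\<lambda>x. f x + g x) - ?P f"
    by (intro pos_part_nonneg_least[OF g(2)]) (smt (verit))
  then show "?P f + ?P g \<le> ?P (\<lambda>x. f x + g x)" by simp
qed

private lemma ppn_scale:
  assumes f: "f \<in> Cc" "\<And>x. 0 \<le> f x" and c: "0 < c"
  shows "pos_part_nonneg lam (\<lambda>x. c * f x) = c * pos_part_nonneg lam f"
proof (rule antisym)
  show "pos_part_nonneg lam (\<lambda>x. c * f x) \<le> c * pos_part_nonneg lam f"
  proof (rule pos_part_nonneg_least)
    fix g assume g: "g \<in> Cc" "\<And>x. 0 \<le> g x" "\<And>x. g x \<le> c * f x"
    have "lam (\<lambda>x. (1/c) * g x) \<le> pos_part_nonneg lam f"
      using f g c by (intro pos_part_nonneg_upper Cc_cmult) (auto simp: field_simps)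
    then show "lam g \<le> c * pos_part_nonneg lam f"
      unfolding linear_rm_cmult[OF lin g(1)] using c by (simp add: field_simps)
  qed (use f c in auto)
  have "pos_part_nonneg lam f \<le> (1/c) * pos_part_nonneg lam (\<lambda>x. c * f x)"
  proof (rule pos_part_nonneg_least[OF f(2)])
    fix g assume g: "g \<in> Cc" "\<And>x. 0 \<le> g x" "\<And>x. g x \<le> f x"
    have "lam (\<lambda>x. c * g x) \<le> pos_part_nonneg lam (\<lambda>x. c * f x)"
      using f g c by (intro pos_part_nonneg_upper Cc_cmult) auto
    then show "lam g \<le> (1/c) * pos_part_nonneg lam (\<lambda>x. c * f x)"
      unfolding linear_rm_cmult[OF lin g(1)] using c by (simp add: field_simps)
  qed
  then show "c * pos_part_nonneg lam f \<le> pos_part_nonneg lam (\<lambda>x. c * f x)"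
    using c by (simp add: field_simps)
qed

private lemma ppn_zero: "pos_part_nonneg lam (\<lambda>x. 0) = 0"
  using ppn_add[of "\<lambda>x. 0" "\<lambda>x. 0"] by simp

text \<open>The value of \<open>pos_part\<close> does not depend on how a function is written as a
  difference of nonnegative ones; linearity then reduces to additivity and scaling on nonnegative
  functions.\<close>

private lemma pos_part_diff:
  assumes u: "u \<in> Cc" "\<And>x. 0 \<le> u x" and v: "v \<in> Cc" "\<And>x. 0 \<le> v x"
  shows "pos_part lam (\<lambda>x. u x - v x) = pos_part_nonneg lam u - pos_part_nonneg lam v"
proof -
  let ?p = "\<lambda>x. max (u x - v x) 0" and ?n = "\<lambda>x. max (- (u x - v x)) 0"
  have c: "?p \<in> Cc" "?n \<in> Cc" using u v by (auto intro!: Cc_max Cc_diff)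
  have "(\<lambda>x. ?p x + v x) = (\<lambda>x. ?n x + u x)" by (auto simp: max_def)
  then have "pos_part_nonneg lam ?p + pos_part_nonneg lam v = pos_part_nonneg lam ?n + pos_part_nonneg lam u"
    using ppn_add[OF c(1) _ v] ppn_add[OF c(2) _ u] by simp
  then show ?thesis using Cc_diff[OF u(1) v(1)] by (simp add: pos_part_def)
qed

lemma pos_part_eq_nonneg:
  assumes "f \<in> Cc" "\<And>x. 0 \<le> f x"
  shows "pos_part lam f = pos_part_nonneg lam f"
  using pos_part_diff[OF assms, of "\<lambda>x. 0"] ppn_zero by simp

lemma poslin_pos_part: "poslin_rm (pos_part lam)"
  unfolding poslin_rm_def linear_rm_def positive_rm_def
proof (intro conjI allI ballI impI)
  fix f g :: "'b \<Rightarrow> real" and c :: real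
  assume f: "f \<in> Cc"
  let ?p = "\<lambda>f x. max (f x) 0" and ?n = "\<lambda>f x. max (- f x) (0::real)"
  have pn: "?p f \<in> Cc" "?n f \<in> Cc" if "f \<in> Cc" for f :: "'b \<Rightarrow> real"
    using that by auto
  have dec: "pos_part lam f = pos_part_nonneg lam (?p f) - pos_part_nonneg lam (?n f)" if "f \<in> Cc" for f
    using that by (simp add: pos_part_def)
  {
    assume g: "g \<in> Cc"
    have "(\<lambda>x. f x + g x) = (\<lambda>x. (?p f x + ?p g x) - (?n f x + ?n g x))" by (auto simp: max_def)
    then have "pos_part lam (\<lambda>x. f x + g x)
      = pos_part_nonneg lam (\<lambda>x. ?p f x + ?p g x) - pos_part_nonneg lam (\<lambda>x. ?n f x + ?n g x)"
      using pos_part_diff[of "\<lambda>x. ?p f x + ?p g x" "\<lambda>x. ?n f x + ?n g x"] pn[OF f] pn[OF g] by auto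
    then show "pos_part lam (\<lambda>x. f x + g x) = pos_part lam f + pos_part lam g"
      using ppn_add[OF pn(1)[OF f] _ pn(1)[OF g]] ppn_add[OF pn(2)[OF f] _ pn(2)[OF g]] dec[OF f] dec[OF g]
      by simp
  }
  consider "c = 0" | "c > 0" | "c < 0" by linarith
  then show "pos_part lam (\<lambda>x. c * f x) = c * pos_part lam f"
  proof cases
    case 1
    then show ?thesis using pos_part_diff[of "\<lambda>x. 0" "\<lambda>x. 0"] by simp
  next
    case 2
    have "(\<lambda>x. c * f x) = (\<lambda>x. c * ?p f x - c * ?n f x)" by (auto simp: max_def)
    moreover have "pos_part lam (\<lambda>x. c * ?p f x - c * ?n f x)
        = pos_part_nonneg lam (\<lambda>x. c * ?p f x) - pos_part_nonneg lam (\<lambda>x. c * ?n f x)"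
      using pn[OF f] 2 by (intro pos_part_diff Cc_cmult) auto
    ultimately have "pos_part lam (\<lambda>x. c * f x)
        = c * pos_part_nonneg lam (?p f) - c * pos_part_nonneg lam (?n f)"
      using ppn_scale[OF pn(1)[OF f] _ 2] ppn_scale[OF pn(2)[OF f] _ 2] by simp
    then show ?thesis unfolding dec[OF f] by (simp add: right_diff_distrib)
  next
    case 3
    then have c: "-c > 0" by simp
    have "(\<lambda>x. c * f x) = (\<lambda>x. (-c) * ?n f x - (-c) * ?p f x)" by (auto simp: max_def)
    moreover have "pos_part lam (\<lambda>x. (-c) * ?n f x - (-c) * ?p f x)
        = pos_part_nonneg lam (\<lambda>x. (-c) * ?n f x) - pos_part_nonneg lam (\<lambda>x. (-c) * ?p f x)"
      using pn[OF f] c by (intro pos_part_diff Cc_cmult mult_nonneg_nonneg) auto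
    ultimately have "pos_part lam (\<lambda>x. c * f x)
        = (-c) * pos_part_nonneg lam (?n f) - (-c) * pos_part_nonneg lam (?p f)"
      using ppn_scale[OF pn(1)[OF f] _ c] ppn_scale[OF pn(2)[OF f] _ c] by simp
    then show ?thesis unfolding dec[OF f] by (simp add: right_diff_distrib)
  qed
next
  fix f :: "'b \<Rightarrow> real" assume "f \<notin> Cc" then show "pos_part lam f = 0" by (simp add: pos_part_def)
next
  fix f :: "'b \<Rightarrow> real" assume "f \<in> Cc" "\<forall>x. 0 \<le> f x"
  then show "0 \<le> pos_part lam f" using pos_part_eq_nonneg[of f] ppn_ge0[of f] by simp
qed

text \<open>The reflection of \<open>g\<close> to \<open>f - g\<close> turns values of
  \<open>- lam\<close> into values of \<open>lam\<close>, up to the constant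
  \<open>lam f\<close>.\<close>

lemma order_bounded_uminus: "order_bounded_rm (- lam)"
  unfolding order_bounded_rm_def
proof (intro ballI bdd_aboveI)
  fix f :: "'b \<Rightarrow> real" and t
  assume f: "f \<in> Cc" and "t \<in> {(- lam) g |g. g \<in> Cc \<and> (\<forall>x. 0 \<le> g x \<and> g x \<le> f x)}"
  then obtain g where g: "t = - lam g" "g \<in> Cc" "\<And>x. 0 \<le> g x" "\<And>x. g x \<le> f x" by auto
  have "lam (\<lambda>x. f x - g x) \<le> pos_part_nonneg lam f"
    using f g by (intro pos_part_nonneg_upper) auto
  then show "t \<le> pos_part_nonneg lam f - lam f" using linear_rm_diff[OF lin f g(2)] g(1) by simp
qed

end

text \<open>Again by the reflection of \<open>g\<close> to \<open>f - g\<close>. Used for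
  \<open>lam\<close> and for \<open>- lam\<close>, it yields equality and hence
  \<open>neg_part_eq\<close>.\<close>

lemma pos_part_nonneg_le:
  assumes "linear_rm lam" "order_bounded_rm lam" "f \<in> Cc" "\<And>x. 0 \<le> f x"
  shows "pos_part_nonneg lam f \<le> pos_part_nonneg (- lam) f + lam f"
proof (rule pos_part_nonneg_least[OF assms(1,2,4)])
  fix g assume g: "g \<in> Cc" "\<And>x. 0 \<le> g x" "\<And>x. g x \<le> f x"
  have "(- lam) (\<lambda>x. f x - g x) \<le> pos_part_nonneg (- lam) f"
    using g assms(3)
    by (intro pos_part_nonneg_upper[OF linear_rm_neg[OF assms(1)] order_bounded_uminus[OF assms(1,2)]]) auto
  then show "lam g \<le> pos_part_nonneg (- lam) f + lam f"
    using linear_rm_diff[OF assms(1,3) g(1)] by simp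
qed

lemma linear_rm_eqI:
  assumes "linear_rm a" "linear_rm b" "\<And>f. f \<in> Cc \<Longrightarrow> (\<And>x. 0 \<le> f x) \<Longrightarrow> a f = b f"
  shows "a = b"
proof
  fix f
  show "a f = b f"
  proof (cases "f \<in> Cc")
    case True
    let ?p = "\<lambda>x. max (f x) 0" and ?n = "\<lambda>x. max (- f x) 0"
    have c: "?p \<in> Cc" "?n \<in> Cc" using True by auto
    have "(\<lambda>x. ?p x - ?n x) = f" by (auto simp: max_def)
    then show ?thesis
      using linear_rm_diff[OF assms(1) c] linear_rm_diff[OF assms(2) c] assms(3)[OF c(1)] assms(3)[OF c(2)]
      by simp
  qed (use assms in \<open>simp add: linear_rm_def\<close>)
qed

lemma neg_part_eq:
  assumes "linear_rm lam" "order_bounded_rm lam"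
  shows "neg_part lam = pos_part lam - lam"
proof (rule linear_rm_eqI)
  note n = linear_rm_neg[OF assms(1)] order_bounded_uminus[OF assms]
  show "linear_rm (neg_part lam)" "linear_rm (pos_part lam - lam)"
    using poslin_pos_part[OF assms] poslin_pos_part[OF n] assms
    by (auto simp: neg_part_def poslin_rm_def intro: linear_rm_minus)
  fix f :: "'a \<Rightarrow> real" assume f: "f \<in> Cc" "\<And>x. 0 \<le> f x"
  show "neg_part lam f = (pos_part lam - lam) f"
    using pos_part_nonneg_le[OF assms f] pos_part_nonneg_le[OF n f]
      pos_part_eq_nonneg[OF assms f] pos_part_eq_nonneg[OF n f]
    by (simp add: neg_part_def)
qed

lemma poslin_neg_part: "linear_rm lam \<Longrightarrow> order_bounded_rm lam \<Longrightarrow> poslin_rm (neg_part lam)"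
  unfolding neg_part_def by (intro poslin_pos_part linear_rm_neg order_bounded_uminus)

lemma order_bounded_minus:
  assumes "poslin_rm a" "poslin_rm b"
  shows "order_bounded_rm (a - b)"
  unfolding order_bounded_rm_def
proof (intro ballI bdd_aboveI)
  fix f :: "'a \<Rightarrow> real" and t
  assume f: "f \<in> Cc" and "t \<in> {(a - b) g |g. g \<in> Cc \<and> (\<forall>x. 0 \<le> g x \<and> g x \<le> f x)}"
  then obtain g where "t = a g - b g" "g \<in> Cc" "\<And>x. 0 \<le> g x" "\<And>x. g x \<le> f x" by auto
  then show "t \<le> a f"
    using poslin_rm_mono[OF assms(1), of g f] poslin_rm_nonneg[OF assms(2), of g] f by auto
qed

text \<open>Minimality of the Jordan decomposition. In \<open>energy_minus\<close> it makes the
  surplus of \<open>a\<close> over the positive part a positive functional.\<close>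

lemma pos_part_minus_le:
  assumes "poslin_rm a" "poslin_rm b" "f \<in> Cc" "\<And>x. 0 \<le> f x"
  shows "pos_part (a - b) f \<le> a f"
proof -
  note l = linear_rm_minus[OF assms(1,2)[THEN poslin_rmD]] order_bounded_minus[OF assms(1,2)]
  show ?thesis unfolding pos_part_eq_nonneg[OF l assms(3,4)]
  proof (rule pos_part_nonneg_least[OF l assms(4)])
    fix g assume "g \<in> Cc" "\<And>x. 0 \<le> g x" "\<And>x. g x \<le> f x"
    then show "(a - b) g \<le> a f"
      using poslin_rm_mono[OF assms(1), of g f] poslin_rm_nonneg[OF assms(2), of g] assms(3) by auto
  qed
qed

lemma pos_part_poslin:
  assumes "poslin_rm a"
  shows "pos_part a = a"
proof (rule linear_rm_eqI)
  have l: "linear_rm a" "order_bounded_rm a"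
    using assms order_bounded_minus[OF assms poslin_rm_zero]
    by (auto simp: poslin_rm_def fun_diff_def)
  show "linear_rm (pos_part a)" "linear_rm a" using poslin_pos_part[OF l] l by (auto simp: poslin_rm_def)
  fix f :: "'a \<Rightarrow> real" assume f: "f \<in> Cc" "\<And>x. 0 \<le> f x"
  show "pos_part a f = a f"
    unfolding pos_part_eq_nonneg[OF l f]
    by (intro antisym pos_part_nonneg_least[OF l f(2)] pos_part_nonneg_upper[OF l f(1) f(1) f(2)] order_refl
        poslin_rm_mono[OF assms _ f(1)])
qed

section \<open>Radon measures and tensor products\<close>

lemma real_radon_linear: "real_radon \<nu> \<Longrightarrow> linear_rm \<nu>"
  by (simp add: real_radon_def linear_rm_def)

text \<open>A nonnegative \<open>M\<close> lets any uniform bound \<open>B\<close> replace the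
  supremum, which is the form in which estimates arise.\<close>

lemma real_radon_bound:
  assumes "real_radon \<nu>" "compact K"
  obtains M where "0 \<le> M" "\<And>f B. f \<in> Cc \<Longrightarrow> tsupp f \<subseteq> K \<Longrightarrow> (\<And>x. \<bar>f x\<bar> \<le> B) \<Longrightarrow> \<bar>\<nu> f\<bar> \<le> M * B"
proof -
  obtain M where M: "\<forall>f\<in>Cc. tsupp f \<subseteq> K \<longrightarrow> \<bar>\<nu> f\<bar> \<le> M * (SUP x. \<bar>f x\<bar>)"
    using assms by (auto simp: real_radon_def)
  show ?thesis
  proof (rule that[of "max M 0"])
    fix f :: "'a \<Rightarrow> real" and B assume f: "f \<in> Cc" "tsupp f \<subseteq> K" "\<And>x. \<bar>f x\<bar> \<le> B"
    have "\<bar>\<nu> f\<bar> \<le> M * (SUP x. \<bar>f x\<bar>)" using M f by blast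
    also have "\<dots> \<le> max M 0 * (SUP x. \<bar>f x\<bar>)"
      using SUP_abs_Cc_nonneg[OF f(1)] by (intro mult_right_mono) auto
    also have "\<dots> \<le> max M 0 * B" using SUP_abs_le[OF f(3)] by (intro mult_left_mono) auto
    finally show "\<bar>\<nu> f\<bar> \<le> max M 0 * B" .
  qed auto
qed

lemma real_radon_order_bounded:
  assumes "real_radon \<nu>"
  shows "order_bounded_rm \<nu>"
  unfolding order_bounded_rm_def
proof (intro ballI)
  fix f :: "'a \<Rightarrow> real" assume f: "f \<in> Cc"
  obtain M where M: "\<And>g B. g \<in> Cc \<Longrightarrow> tsupp g \<subseteq> tsupp f \<Longrightarrow> (\<And>x. \<bar>g x\<bar> \<le> B) \<Longrightarrow> \<bar>\<nu> g\<bar> \<le> M * B"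
    using real_radon_bound[OF assms Cc_compact_tsupp[OF f]] by blast
  obtain B where B: "\<And>x. \<bar>f x\<bar> \<le> B" using Cc_bounded[OF f] by blast
  show "bdd_above {\<nu> g |g. g \<in> Cc \<and> (\<forall>x. 0 \<le> g x \<and> g x \<le> f x)}"
  proof (rule bdd_aboveI)
    fix t assume "t \<in> {\<nu> g |g. g \<in> Cc \<and> (\<forall>x. 0 \<le> g x \<and> g x \<le> f x)}"
    then obtain g where g: "t = \<nu> g" "g \<in> Cc" "\<And>x. 0 \<le> g x" "\<And>x. g x \<le> f x" by auto
    have "tsupp g \<subseteq> tsupp f"
    proof (rule tsupp_minimal)
      fix x assume "x \<notin> tsupp f"
      then show "g x = 0" using g(3)[of x] g(4)[of x] eq_0_outside_tsupp[of x f] by simp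
    qed simp
    moreover have "\<bar>g x\<bar> \<le> B" for x using g(3)[of x] g(4)[of x] B[of x] by simp
    ultimately show "t \<le> M * B" using M[OF g(2)] g(1) by (meson abs_le_D1)
  qed
qed

text \<open>\<open>K\<close> is covered by finitely many open sets, each inside a compact set.
  Separating \<open>K\<close> from the complement of \<open>V\<close>, the part of their union
  inside \<open>U\<close>, gives a function that vanishes off \<open>U\<close> and off a compact
  set.\<close>

lemma Cc_Urysohn:
  fixes K :: "'a::t2_space set"
  assumes lc: "locally_compact_space (euclidean :: 'a topology)" and "compact K" "open U" "K \<subseteq> U"
  obtains \<phi> where "\<phi> \<in> Cc" "\<forall>x. 0 \<le> \<phi> x \<and> \<phi> x \<le> 1" "\<forall>x\<in>K. \<phi> x = 1" "\<forall>x. x \<notin> U \<longrightarrow> \<phi> x = 0"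
proof -
  have H: "Hausdorff_space (euclidean :: 'a topology)"
    unfolding Hausdorff_space_def using hausdorff by (auto simp: disjnt_def)
  define WW where "WW = {W::'a set. open W \<and> (\<exists>L. compact L \<and> W \<subseteq> L)}"
  have "\<exists>W\<in>WW. x \<in> W" for x
    using lc by (fastforce simp: locally_compact_space_def WW_def)
  then have "K \<subseteq> \<Union>WW" by blast
  then obtain T where T: "T \<subseteq> WW" "finite T" "K \<subseteq> \<Union>T"
    using compactE[OF \<open>compact K\<close>, of WW] unfolding WW_def by blast
  have "\<exists>C. compact C \<and> \<Union>T \<subseteq> C" using T(2,1)
  proof (induction T rule: finite_induct)
    case (insert W T)
    then obtain C L where "compact C" "\<Union>T \<subseteq> C" "compact L" "W \<subseteq> L" unfolding WW_def by auto
    then have "compact (C \<union> L)" "\<Union>(insert W T) \<subseteq> C \<union> L" by auto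
    then show ?case by blast
  next
    case empty
    show ?case by (rule exI[of _ "{}"]) simp
  qed
  then obtain C where C: "compact C" "\<Union>T \<subseteq> C" by (elim exE conjE)
  define V where "V = U \<inter> \<Union>T"
  have "regular_space (euclidean :: 'a topology)"
    using locally_compact_Hausdorff_imp_regular_space lc H by blast
  then have "completely_regular_space (euclidean :: 'a topology)"
    using locally_compact_regular_imp_completely_regular_space lc H by blast
  moreover have "closed (- V)" unfolding V_def using assms T(1) by (auto simp: WW_def intro!: open_Union)
  moreover have "disjnt K (- V)" unfolding V_def disjnt_def using T(3) \<open>K \<subseteq> U\<close> by blast
  ultimately obtain f where f: "continuous_map euclidean (top_of_set {0..1::real}) f"
      "f ` (- V) \<subseteq> {0}" "f ` K \<subseteq> {1}"
    using Urysohn_completely_regular_compact_closed[of 0 1 "euclidean :: 'a topology" K "- V"]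
      \<open>compact K\<close> by auto
  have "continuous_on UNIV f" "\<And>x. f x \<in> {0..1}"
    using f(1) by (auto simp: continuous_map_in_subtopology)
  moreover have "f x = 0" if "x \<notin> C" for x
    using that f(2) C(2) unfolding V_def by blast
  moreover have "f x = 0" if "x \<notin> U" for x
    using that f(2) unfolding V_def by blast
  ultimately show ?thesis using C f(3) compact_imp_closed[OF C(1)]
    by (intro that[of f] CcI[of f C]) auto
qed

text \<open>Positivity gives the local bound: a function supported in \<open>K\<close> is dominated
  by its supremum norm times a fixed \<phi> equal to 1 on \<open>K\<close>, so
  \<open>a \<phi>\<close> serves as the constant.\<close>

lemma poslin_rm_real_radon:
  fixes a :: "'a::t2_space rmeas"
  assumes lc: "locally_compact_space (euclidean :: 'a topology)" and a: "poslin_rm a"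
  shows "real_radon a"
proof -
  have "\<exists>M. \<forall>f\<in>Cc. tsupp f \<subseteq> K \<longrightarrow> \<bar>a f\<bar> \<le> M * (SUP x. \<bar>f x\<bar>)" if K: "compact K" for K
  proof -
    obtain \<phi> where \<phi>: "\<phi> \<in> Cc" "\<forall>x. 0 \<le> \<phi> x \<and> \<phi> x \<le> 1"
        "\<forall>x\<in>K. \<phi> x = 1" "\<forall>x. x \<notin> UNIV \<longrightarrow> \<phi> x = 0"
      by (rule Cc_Urysohn[OF lc K open_UNIV subset_UNIV])
    have "\<bar>a f\<bar> \<le> a \<phi> * (SUP x. \<bar>f x\<bar>)" if f: "f \<in> Cc" "tsupp f \<subseteq> K" for f
    proof -
      let ?S = "SUP x. \<bar>f x\<bar>"
      have "\<bar>f x\<bar> \<le> ?S * \<phi> x" for x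
      proof (cases "x \<in> K")
        case True
        then show ?thesis using abs_le_SUP_Cc[OF f(1), of x] \<phi>(3) by simp
      next
        case False
        then have "f x = 0" using f(2) by (intro eq_0_outside_tsupp) auto
        then show ?thesis using \<phi>(2) SUP_abs_Cc_nonneg[OF f(1)] by simp
      qed
      then have "\<bar>a f\<bar> \<le> a (\<lambda>x. ?S * \<phi> x)"
        using f \<phi> by (intro poslin_rm_abs[OF a]) auto
      then show ?thesis using linear_rm_cmult[OF poslin_rmD[OF a] \<phi>(1), of ?S] by (simp add: mult.commute)
    qed
    then show ?thesis by blast
  qed
  then show ?thesis using poslin_rmD[OF a] by (simp add: real_radon_def linear_rm_def)
qed

lemma real_radon_minus:
  assumes "real_radon a" "real_radon b"
  shows "real_radon (a - b)"
proof -
  have "\<exists>M. \<forall>f\<in>Cc. tsupp f \<subseteq> K \<longrightarrow> \<bar>(a - b) f\<bar> \<le> M * (SUP x. \<bar>f x\<bar>)" if K: "compact K" for K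
  proof -
    obtain M where M: "\<And>f B. f \<in> Cc \<Longrightarrow> tsupp f \<subseteq> K \<Longrightarrow> (\<And>x. \<bar>f x\<bar> \<le> B) \<Longrightarrow> \<bar>a f\<bar> \<le> M * B"
      using real_radon_bound[OF assms(1) K] by blast
    obtain N where N: "\<And>f B. f \<in> Cc \<Longrightarrow> tsupp f \<subseteq> K \<Longrightarrow> (\<And>x. \<bar>f x\<bar> \<le> B) \<Longrightarrow> \<bar>b f\<bar> \<le> N * B"
      using real_radon_bound[OF assms(2) K] by blast
    have "\<bar>(a - b) f\<bar> \<le> (M + N) * (SUP x. \<bar>f x\<bar>)" if f: "f \<in> Cc" "tsupp f \<subseteq> K" for f
      using M[OF f abs_le_SUP_Cc[OF f(1)]] N[OF f abs_le_SUP_Cc[OF f(1)]]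
      by (simp add: distrib_right)
    then show ?thesis by blast
  qed
  then show ?thesis
    using linear_rm_minus[OF assms[THEN real_radon_linear]] by (simp add: real_radon_def linear_rm_def)
qed

section \<open>Sections, partial integrals and tensor products\<close>

lemma Cc_section:
  fixes f :: "'a::t2_space \<times> 'a \<Rightarrow> real"
  assumes "f \<in> Cc"
  shows "(\<lambda>y. f (x, y)) \<in> Cc"
proof (rule CcI)
  show "continuous_on UNIV (\<lambda>y. f (x, y))"
    by (rule continuous_on_compose2[OF Cc_continuous[OF assms]]) (auto intro!: continuous_intros)
  show K: "compact (snd ` tsupp f)"
    by (intro compact_continuous_image Cc_compact_tsupp assms continuous_intros)
  show "closed (snd ` tsupp f)" by (rule compact_imp_closed[OF K])
  fix y assume "y \<notin> snd ` tsupp f"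
  then have "(x, y) \<notin> tsupp f" by force
  then show "f (x, y) = 0" by (rule eq_0_outside_tsupp)
qed

lemma compact_fst_tsupp: "f \<in> Cc \<Longrightarrow> compact (fst ` tsupp f)"
  and compact_snd_tsupp: "f \<in> Cc \<Longrightarrow> compact (snd ` tsupp f)"
  by (auto intro!: compact_continuous_image Cc_compact_tsupp continuous_intros)

lemma section_eq_0:
  shows "x \<notin> fst ` tsupp f \<Longrightarrow> f (x, y) = 0" and "y \<notin> snd ` tsupp f \<Longrightarrow> f (x, y) = 0"
  using eq_0_outside_tsupp[of "(x, y)" f] by force+

lemma Cc_sections_close:
  fixes f :: "'a::t2_space \<times> 'a \<Rightarrow> real"
  assumes "f \<in> Cc" "0 < e"
  obtains U where "open U" "x0 \<in> U" "\<And>x y. x \<in> U \<Longrightarrow> \<bar>f (x, y) - f (x0, y)\<bar> \<le> e"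
proof -
  obtain U where U: "x0 \<in> U" "open U" "\<forall>x\<in>U \<inter> UNIV. \<forall>t\<in>snd ` tsupp f. dist (f (x, t)) (f (x0, t)) \<le> e"
    using continuous_on_prod_compactE[of UNIV "snd ` tsupp f" f x0 e]
      continuous_on_subset[OF Cc_continuous[OF assms(1)]] compact_snd_tsupp[OF assms(1)] assms(2)
    by (metis UNIV_I subset_UNIV)
  have "\<bar>f (x, y) - f (x0, y)\<bar> \<le> e" if "x \<in> U" for x y
    using U(3) that section_eq_0(2)[of y f] assms(2)
    by (cases "y \<in> snd ` tsupp f") (auto simp: dist_real_def)
  then show ?thesis using that U by blast
qed

lemma Cc_partial_integral:
  fixes f :: "'a::t2_space \<times> 'a \<Rightarrow> real"
  assumes f: "f \<in> Cc" and \<nu>: "real_radon \<nu>"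
  shows "(\<lambda>x. \<nu> (\<lambda>y. f (x, y))) \<in> Cc"
proof (rule CcI)
  obtain M where M: "0 \<le> M"
      "\<And>g B. g \<in> Cc \<Longrightarrow> tsupp g \<subseteq> snd ` tsupp f \<Longrightarrow> (\<And>x. \<bar>g x\<bar> \<le> B) \<Longrightarrow> \<bar>\<nu> g\<bar> \<le> M * B"
    using real_radon_bound[OF \<nu> compact_snd_tsupp[OF f]] by blast
  show "continuous_on UNIV (\<lambda>x. \<nu> (\<lambda>y. f (x, y)))"
    unfolding continuous_on_eq_continuous_at[OF open_UNIV]
  proof (intro ballI)
    fix x0
    show "isCont (\<lambda>x. \<nu> (\<lambda>y. f (x, y))) x0"
      unfolding isCont_def
    proof (rule tendstoI)
      fix e :: real assume "0 < e"
      \<comment> \<open>\<open>M\<close> may be 0, and a strict inequality is wanted below; hence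
        \<open>M + 1\<close>.\<close>
      then have e: "0 < e / (M + 1)" using M(1) by simp
      obtain U where U: "open U" "x0 \<in> U" "\<And>x y. x \<in> U \<Longrightarrow> \<bar>f (x, y) - f (x0, y)\<bar> \<le> e / (M + 1)"
        using Cc_sections_close[OF f e] by blast
      have "dist (\<nu> (\<lambda>y. f (x, y))) (\<nu> (\<lambda>y. f (x0, y))) < e" if "x \<in> U" for x
      proof -
        have "tsupp (\<lambda>y. f (x, y) - f (x0, y)) \<subseteq> snd ` tsupp f"
          by (rule tsupp_minimal) (auto simp: section_eq_0 compact_imp_closed[OF compact_snd_tsupp[OF f]])
        then have "\<bar>\<nu> (\<lambda>y. f (x, y) - f (x0, y))\<bar> \<le> M * (e / (M + 1))"
          using U(3)[OF that] Cc_section[OF f] by (intro M(2)) auto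
        also have "\<dots> < e" using M(1) \<open>0 < e\<close> by (simp add: field_simps)
        finally show ?thesis
          using linear_rm_diff[OF real_radon_linear[OF \<nu>] Cc_section[OF f, of x] Cc_section[OF f, of x0]]
          by (simp add: dist_real_def)
      qed
      then show "\<forall>\<^sub>F x in at x0. dist (\<nu> (\<lambda>y. f (x, y))) (\<nu> (\<lambda>y. f (x0, y))) < e"
        using U(1,2) eventually_at_topological by blast
    qed
  qed
  show "compact (fst ` tsupp f)" "closed (fst ` tsupp f)"
    using compact_fst_tsupp[OF f] compact_imp_closed by auto
  show "\<nu> (\<lambda>y. f (x, y)) = 0" if "x \<notin> fst ` tsupp f" for x
    using section_eq_0(1)[OF that] linear_rm_zero[OF real_radon_linear[OF \<nu>]] by simp
qed

lemma linear_tensor: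
  fixes \<mu> \<nu> :: "'a::t2_space rmeas"
  assumes \<mu>: "real_radon \<mu>" and \<nu>: "real_radon \<nu>"
  shows "linear_rm (tensor \<mu> \<nu>)"
  unfolding linear_rm_def
proof (intro conjI allI ballI impI)
  fix f g :: "'a \<times> 'a \<Rightarrow> real" and c :: real assume f: "f \<in> Cc"
  note l = real_radon_linear[OF \<mu>] real_radon_linear[OF \<nu>]
  show "tensor \<mu> \<nu> (\<lambda>x. c * f x) = c * tensor \<mu> \<nu> f"
    using f linear_rm_cmult[OF l(2) Cc_section[OF f]] linear_rm_cmult[OF l(1) Cc_partial_integral[OF f \<nu>]]
    by (simp add: tensor_def)
  assume g: "g \<in> Cc"
  show "tensor \<mu> \<nu> (\<lambda>x. f x + g x) = tensor \<mu> \<nu> f + tensor \<mu> \<nu> g"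
    using f g linear_rm_add[OF l(2) Cc_section[OF f] Cc_section[OF g]]
      linear_rm_add[OF l(1) Cc_partial_integral[OF f \<nu>] Cc_partial_integral[OF g \<nu>]]
    by (simp add: tensor_def)
qed (simp add: tensor_def)

lemma poslin_tensor:
  fixes \<mu> \<nu> :: "'a::t2_space rmeas"
  assumes "real_radon \<mu>" "real_radon \<nu>" "poslin_rm \<mu>" "poslin_rm \<nu>"
  shows "poslin_rm (tensor \<mu> \<nu>)"
  using linear_tensor[OF assms(1,2)]
  by (auto simp: poslin_rm_def[of "tensor \<mu> \<nu>"] positive_rm_def tensor_def
      intro!: poslin_rm_nonneg[OF assms(3)] poslin_rm_nonneg[OF assms(4)])

lemma tensor_plus_left: "tensor (a + b) c = tensor a c + tensor b c"
  and tensor_minus_left: "tensor (a - b) c = tensor a c - tensor b c"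
  and tensor_scale_left: "tensor (\<lambda>f. r * a f) c = (\<lambda>f. r * tensor a c f)"
  by (auto simp: tensor_def fun_eq_iff)

text \<open>In the right factor, additivity is that of the outer functional \<open>a\<close> on
  partial integrals, and so depends on these lying in \<open>Cc\<close>.\<close>

lemma tensor_plus_right:
  fixes a b c :: "'a::t2_space rmeas"
  assumes "real_radon a" "real_radon b" "real_radon c"
  shows "tensor a (b + c) = tensor a b + tensor a c"
proof
  fix f :: "'a \<times> 'a \<Rightarrow> real"
  show "tensor a (b + c) f = (tensor a b + tensor a c) f"
    using linear_rm_add[OF real_radon_linear[OF assms(1)] Cc_partial_integral[OF _ assms(2), of f]
        Cc_partial_integral[OF _ assms(3), of f]]
    by (cases "f \<in> Cc") (simp_all add: tensor_def)
qed

lemma tensor_minus_right: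
  fixes a b c :: "'a::t2_space rmeas"
  assumes "real_radon a" "real_radon b" "real_radon c"
  shows "tensor a (b - c) = tensor a b - tensor a c"
proof
  fix f :: "'a \<times> 'a \<Rightarrow> real"
  show "tensor a (b - c) f = (tensor a b - tensor a c) f"
    using linear_rm_diff[OF real_radon_linear[OF assms(1)] Cc_partial_integral[OF _ assms(2), of f]
        Cc_partial_integral[OF _ assms(3), of f]]
    by (cases "f \<in> Cc") (simp_all add: tensor_def)
qed

lemma tensor_scale_right:
  fixes a b :: "'a::t2_space rmeas"
  assumes "real_radon a" "real_radon b"
  shows "tensor a (\<lambda>f. r * b f) = (\<lambda>f. r * tensor a b f)"
proof
  fix f :: "'a \<times> 'a \<Rightarrow> real"
  show "tensor a (\<lambda>f. r * b f) f = r * tensor a b f"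
    using linear_rm_cmult[OF real_radon_linear[OF assms(1)] Cc_partial_integral[OF _ assms(2), of f]]
    by (cases "f \<in> Cc") (simp_all add: tensor_def)
qed

section \<open>Partitions of unity and the positive part of a tensor square\<close>

lemma partition_of_unity:
  fixes K :: "'a::t2_space set"
  assumes lc: "locally_compact_space (euclidean :: 'a topology)" and K: "compact K"
    and U: "\<And>x. open (U x)" "\<And>x. x \<in> U x"
  obtains I \<psi> where "finite I" "\<forall>i. continuous_on UNIV (\<psi> i)" "\<forall>i x. 0 \<le> \<psi> i x"
    "\<forall>i x. \<psi> i x \<noteq> 0 \<longrightarrow> x \<in> U i" "\<forall>x. (\<Sum>i\<in>I. \<psi> i x) \<le> (1::real)" "\<forall>x\<in>K. (\<Sum>i\<in>I. \<psi> i x) = 1"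
proof -
  have "\<exists>\<phi>. \<phi> \<in> Cc \<and> (\<forall>y. 0 \<le> \<phi> y) \<and> \<phi> x = 1 \<and> (\<forall>y. y \<notin> U x \<longrightarrow> \<phi> y = 0)" for x
  proof -
    obtain \<phi> where "\<phi> \<in> Cc" "\<forall>y. 0 \<le> \<phi> y \<and> \<phi> y \<le> 1" "\<forall>y\<in>{x}. \<phi> y = 1" "\<forall>y. y \<notin> U x \<longrightarrow> \<phi> y = 0"
      by (rule Cc_Urysohn[OF lc compact_sing[of x] U(1)[of x]]) (use U(2)[of x] in auto)
    then show ?thesis by auto
  qed
  then have "\<exists>\<phi>. \<forall>x. \<phi> x \<in> Cc \<and> (\<forall>y. 0 \<le> \<phi> x y) \<and> \<phi> x x = 1 \<and> (\<forall>y. y \<notin> U x \<longrightarrow> \<phi> x y = 0)"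
    by (intro choice allI)
  then obtain \<phi> where \<phi>: "\<forall>x. \<phi> x \<in> Cc \<and> (\<forall>y. 0 \<le> \<phi> x y) \<and> \<phi> x x = 1 \<and> (\<forall>y. y \<notin> U x \<longrightarrow> \<phi> x y = 0)"
    by (elim exE)
  have cont: "continuous_on UNIV (\<phi> x)" for x using \<phi> by (simp add: Cc_continuous)
  define V where "V = (\<lambda>x. {y. \<phi> x y > 1/2})"
  have V: "open (V x)" for x
    unfolding V_def using cont[of x] by (intro open_Collect_less) auto
  have "x \<in> V x" for x using \<phi> by (simp add: V_def)
  then have "K \<subseteq> (\<Union>x\<in>K. V x)" by blast
  then obtain I where I: "I \<subseteq> K" "finite I" "K \<subseteq> (\<Union>x\<in>I. V x)"
    using compactE_image[OF K, of K V] V by metis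
  define S where "S = (\<lambda>y. \<Sum>i\<in>I. \<phi> i y)"
  \<comment> \<open>The floor \<open>1/2\<close> keeps the quotient continuous where
    \<open>S\<close> vanishes. On \<open>K\<close> some \<phi> exceeds \<open>1/2\<close>, so there
    the denominator is \<open>S\<close> itself and the sum is 1.\<close>
  define \<psi> where "\<psi> = (\<lambda>i y. \<phi> i y / max (S y) (1/2))"
  have S0: "0 \<le> S y" for y unfolding S_def using \<phi> by (intro sum_nonneg) simp
  have sum: "(\<Sum>i\<in>I. \<psi> i y) = S y / max (S y) (1/2)" for y
    unfolding \<psi>_def S_def by (simp add: sum_divide_distrib)
  have S: "S y > 1/2" if y: "y \<in> K" for y
  proof -
    obtain i where i: "i \<in> I" "\<phi> i y > 1/2" using y I(3) by (auto simp: V_def)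
    have "\<phi> i y \<le> S y" unfolding S_def using \<phi> i I(2) by (intro member_le_sum) auto
    then show ?thesis using i by simp
  qed
  show ?thesis
  proof (rule that[of I \<psi>])
    show "\<forall>i. continuous_on UNIV (\<psi> i)"
      unfolding \<psi>_def S_def using cont
      by (intro allI continuous_intros) (auto simp: max_def)
    show "\<forall>i x. \<psi> i x \<noteq> 0 \<longrightarrow> x \<in> U i" using \<phi> unfolding \<psi>_def by (metis div_0)
    show "\<forall>x. (\<Sum>i\<in>I. \<psi> i x) \<le> 1" unfolding sum using S0 by (auto simp: divide_le_eq_1)
    show "\<forall>x\<in>K. (\<Sum>i\<in>I. \<psi> i x) = 1" unfolding sum using S by (fastforce simp: max_def)
    show "\<forall>i x. 0 \<le> \<psi> i x" unfolding \<psi>_def using \<phi> by (simp add: le_max_iff_disj)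
  qed (rule I(2))
qed

text \<open>A near maximiser of \<nu> below \<open>u\<close> is scaled down when its value
  overshoots \<open>t\<close>. Treating \<open>t \<le> e\<close> separately, with the zero function,
  keeps the divisor \<open>\<nu> g\<close> positive.\<close>

lemma pos_part_interpolate:
  assumes \<nu>: "linear_rm \<nu>" "order_bounded_rm \<nu>" and u: "u \<in> Cc" "\<And>y. 0 \<le> u y"
    and t: "0 \<le> t" "t \<le> pos_part \<nu> u" and e: "0 < e"
  obtains g where "g \<in> Cc" "\<forall>y. 0 \<le> g y \<and> g y \<le> u y" "\<bar>\<nu> g - t\<bar> \<le> e"
proof (cases "t \<le> e")
  case True
  then show ?thesis using u t linear_rm_zero[OF \<nu>(1)] by (intro that[of "\<lambda>x. 0"]) auto
next
  case False
  have "\<exists>g. g \<in> Cc \<and> (\<forall>y. 0 \<le> g y \<and> g y \<le> u y) \<and> t - e < \<nu> g"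
  proof (rule ccontr)
    assume "\<not> ?thesis"
    then have "pos_part_nonneg \<nu> u \<le> t - e"
      by (intro pos_part_nonneg_least[OF \<nu> u(2)]) (meson linorder_not_less)
    then show False using t e pos_part_eq_nonneg[OF \<nu> u] by simp
  qed
  then obtain g where g: "g \<in> Cc" "\<forall>y. 0 \<le> g y \<and> g y \<le> u y" "t - e < \<nu> g" by (elim exE conjE)
  show ?thesis
  proof (cases "\<nu> g \<le> t")
    case True
    then show ?thesis using g by (intro that[of g]) auto
  next
    case f: False
    have r: "0 \<le> t / \<nu> g" "t / \<nu> g \<le> 1" using f t by (auto simp: divide_le_eq_1)
    have "\<nu> (\<lambda>y. (t / \<nu> g) * g y) = t"
      unfolding linear_rm_cmult[OF \<nu>(1) g(1)] using f t by simp
    moreover have "0 \<le> (t / \<nu> g) * g y \<and> (t / \<nu> g) * g y \<le> u y" for y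
      using r g(2) mult_left_le_one_le[of "g y" "t / \<nu> g"] by (meson mult_nonneg_nonneg order_trans)
    ultimately show ?thesis using g(1) e by (intro that[OF Cc_cmult[of g "t / \<nu> g"]]) auto
  qed
qed

text \<open>Closeness is asked only where the weight is nonzero: for a partition of unity it is
  known only on the set belonging to the index.\<close>

lemma abs_convex_comb_le:
  fixes w a :: "'i \<Rightarrow> real"
  assumes "\<And>i. i \<in> I \<Longrightarrow> 0 \<le> w i" "(\<Sum>i\<in>I. w i) = 1" "\<And>i. i \<in> I \<Longrightarrow> w i \<noteq> 0 \<Longrightarrow> \<bar>a i - t\<bar> \<le> e"
  shows "\<bar>(\<Sum>i\<in>I. w i * a i) - t\<bar> \<le> e"
proof -
  have "(\<Sum>i\<in>I. w i * a i) - t = (\<Sum>i\<in>I. w i * a i) - (\<Sum>i\<in>I. w i) * t" using assms(2) by simp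
  also have "\<dots> = (\<Sum>i\<in>I. w i * (a i - t))" by (simp add: sum_distrib_right sum_subtractf right_diff_distrib)
  also have "\<bar>\<dots>\<bar> \<le> (\<Sum>i\<in>I. w i * e)"
  proof (rule order_trans[OF sum_abs], rule sum_mono)
    fix i assume "i \<in> I"
    then show "\<bar>w i * (a i - t)\<bar> \<le> w i * e"
      using assms(1)[of i] assms(3)[of i] by (cases "w i = 0") (auto simp: abs_mult)
  qed
  also have "\<dots> = e" using assms(2) by (simp flip: sum_distrib_right)
  finally show ?thesis .
qed

text \<open>A function below \<open>f\<close> that nearly realises the left-hand side is glued by a partition of unity
from functions nearly realising \<open>\<nu>\<^sup>+ (f (x, \<cdot>))\<close>.\<close>

lemma tensor_pos_part_le:
  fixes \<nu> :: "'a::t2_space rmeas"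
  assumes lc: "locally_compact_space (euclidean :: 'a topology)" and \<nu>: "real_radon \<nu>"
    and bd: "order_bounded_rm (tensor \<nu> \<nu>)" and f: "f \<in> Cc" "\<And>z. 0 \<le> f z"
  shows "tensor (pos_part \<nu>) (pos_part \<nu>) f \<le> pos_part (tensor \<nu> \<nu>) f"
proof -
  note l = real_radon_linear[OF \<nu>] real_radon_order_bounded[OF \<nu>]
  note lt = linear_tensor[OF \<nu> \<nu>] bd
  have pp: "poslin_rm (pos_part \<nu>)" by (rule poslin_pos_part[OF l])
  have rp: "real_radon (pos_part \<nu>)" by (rule poslin_rm_real_radon[OF lc pp])
  define G where "G = (\<lambda>x. pos_part \<nu> (\<lambda>y. f (x, y)))"
  have G: "G \<in> Cc" unfolding G_def by (rule Cc_partial_integral[OF f(1) rp])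
  have G0: "0 \<le> G x" for x unfolding G_def by (intro poslin_rm_nonneg[OF pp] f)
  let ?K = "fst ` tsupp f" and ?L = "snd ` tsupp f"
  have K: "compact ?K" "closed ?K" and L: "compact ?L" "closed ?L"
    using compact_fst_tsupp[OF f(1)] compact_snd_tsupp[OF f(1)] compact_imp_closed by auto
  have GK: "G x = 0" if "x \<notin> ?K" for x
    unfolding G_def using section_eq_0(1)[OF that] linear_rm_zero[OF poslin_rmD[OF pp]] by simp
  obtain M where M: "0 \<le> M" "\<And>f B. f \<in> Cc \<Longrightarrow> tsupp f \<subseteq> ?K \<Longrightarrow> (\<And>x. \<bar>f x\<bar> \<le> B) \<Longrightarrow> \<bar>\<nu> f\<bar> \<le> M * B"
    using real_radon_bound[OF \<nu> K(1)] by blast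
  obtain N where N: "0 \<le> N" "\<And>f B. f \<in> Cc \<Longrightarrow> tsupp f \<subseteq> ?L \<Longrightarrow> (\<And>x. \<bar>f x\<bar> \<le> B) \<Longrightarrow> \<bar>\<nu> f\<bar> \<le> N * B"
    using real_radon_bound[OF \<nu> L(1)] by blast
  \<comment> \<open>The left-hand side of the goal is \<open>pos_part \<nu> G\<close>, a supremum of
    such values \<open>\<nu> h\<close>.\<close>
  have main: "\<nu> h \<le> pos_part (tensor \<nu> \<nu>) f" if h: "h \<in> Cc" "\<And>x. 0 \<le> h x" "\<And>x. h x \<le> G x" for h
  proof (rule field_le_epsilon)
    fix d :: real assume d: "0 < d"
    \<comment> \<open>The construction below costs at most \<open>M * ((N + 2) * e)\<close>; the
      added 1 guards against a zero denominator.\<close>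
    define e where "e = d / (M * (N + 2) + 1)"
    have MN: "0 \<le> M * (N + 2)" using M(1) N(1) by simp
    then have e: "0 < e" using d unfolding e_def by (intro divide_pos_pos) auto
    have "\<exists>g. g \<in> Cc \<and> (\<forall>y. 0 \<le> g y \<and> g y \<le> f (x, y)) \<and> \<bar>\<nu> g - h x\<bar> \<le> e" for x
    proof -
      obtain g where "g \<in> Cc" "\<forall>y. 0 \<le> g y \<and> g y \<le> f (x, y)" "\<bar>\<nu> g - h x\<bar> \<le> e"
        using pos_part_interpolate[OF l Cc_section[OF f(1), of x] f(2) h(2)[of x] _ e] h(3)[of x]
        unfolding G_def by metis
      then show ?thesis by blast
    qed
    then have "\<exists>g. \<forall>x. g x \<in> Cc \<and> (\<forall>y. 0 \<le> g x y \<and> g x y \<le> f (x, y)) \<and> \<bar>\<nu> (g x) - h x\<bar> \<le> e"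
      by (intro choice allI)
    then obtain g where g: "\<forall>x. g x \<in> Cc \<and> (\<forall>y. 0 \<le> g x y \<and> g x y \<le> f (x, y)) \<and> \<bar>\<nu> (g x) - h x\<bar> \<le> e"
      by (elim exE)
    have gC: "g x \<in> Cc" for x using g by simp
    have "\<exists>U. open U \<and> x \<in> U \<and> (\<forall>x'\<in>U. (\<forall>y. \<bar>f (x', y) - f (x, y)\<bar> \<le> e) \<and> \<bar>h x' - h x\<bar> \<le> e)" for x
    proof -
      obtain U where U: "open U" "x \<in> U" "\<And>x' y. x' \<in> U \<Longrightarrow> \<bar>f (x', y) - f (x, y)\<bar> \<le> e"
        using Cc_sections_close[OF f(1) e] by blast
      have "open {x'. \<bar>h x' - h x\<bar> < e}"
        by (intro open_Collect_less continuous_intros Cc_continuous[OF h(1)])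
      then have "open (U \<inter> {x'. \<bar>h x' - h x\<bar> < e})" using U(1) by auto
      then show ?thesis using U(2,3) e by (intro exI[of _ "U \<inter> {x'. \<bar>h x' - h x\<bar> < e}"]) auto
    qed
    then have "\<exists>U. \<forall>x. open (U x) \<and> x \<in> U x \<and> (\<forall>x'\<in>U x. (\<forall>y. \<bar>f (x', y) - f (x, y)\<bar> \<le> e) \<and> \<bar>h x' - h x\<bar> \<le> e)"
      by (intro choice allI)
    then obtain U where U: "\<forall>x. open (U x) \<and> x \<in> U x \<and> (\<forall>x'\<in>U x. (\<forall>y. \<bar>f (x', y) - f (x, y)\<bar> \<le> e) \<and> \<bar>h x' - h x\<bar> \<le> e)"
      by (elim exE)
    have Uo: "\<And>x. open (U x)" "\<And>x. x \<in> U x" using U by auto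
    obtain I \<psi> where I: "finite I" and \<psi>: "\<forall>i. continuous_on UNIV (\<psi> i)" "\<forall>i x. 0 \<le> \<psi> i x"
        "\<forall>i x. \<psi> i x \<noteq> 0 \<longrightarrow> x \<in> U i" "\<forall>x. (\<Sum>i\<in>I. \<psi> i x) \<le> (1::real)" "\<forall>x\<in>?K. (\<Sum>i\<in>I. \<psi> i x) = 1"
      by (rule partition_of_unity[OF lc K(1) Uo])
    \<comment> \<open>\<open>g i\<close> lies below the section of \<open>f\<close> at
      \<open>i\<close>, not at the nearby point \<open>x\<close>. The minimum with \<open>f\<close>
      restores \<open>k \<le> f\<close> and changes \<open>g i\<close> by at most \<open>e\<close>
      on the set \<open>U i\<close>.\<close>
    define k where "k = (\<lambda>z. \<Sum>i\<in>I. \<psi> i (fst z) * min (g i (snd z)) (f z))"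
    have kC: "k \<in> Cc"
    proof (rule Cc_dominated[OF _ f(1)])
      show "continuous_on UNIV k" unfolding k_def
        by (intro continuous_intros Cc_continuous[OF f(1)]
            continuous_on_compose2[OF Cc_continuous[OF gC]] continuous_on_compose2[OF \<psi>(1)[rule_format]]) auto
      fix z assume z: "f z = 0"
      have "min (g i (snd z)) (f z) = 0" for i using g z by (simp add: min_def antisym)
      then show "k z = 0" unfolding k_def by simp
    qed
    have k0: "0 \<le> k z" for z
      unfolding k_def using \<psi>(2) g f(2) by (intro sum_nonneg mult_nonneg_nonneg) auto
    have kf: "k z \<le> f z" for z
    proof -
      have "k z \<le> (\<Sum>i\<in>I. \<psi> i (fst z) * f z)"
        unfolding k_def using \<psi>(2) by (intro sum_mono mult_left_mono) auto
      also have "\<dots> = (\<Sum>i\<in>I. \<psi> i (fst z)) * f z" by (simp add: sum_distrib_right)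
      also have "\<dots> \<le> 1 * f z" using \<psi>(4) f(2) by (intro mult_right_mono) auto
      finally show ?thesis by simp
    qed
    have mC: "(\<lambda>y. min (g i y) (f (x, y))) \<in> Cc" for i x
      using gC Cc_section[OF f(1)] by simp
    have k\<nu>: "\<nu> (\<lambda>y. k (x, y)) = (\<Sum>i\<in>I. \<psi> i x * \<nu> (\<lambda>y. min (g i y) (f (x, y))))" for x
      unfolding k_def using linear_rm_sum[OF l(1) I, of "\<lambda>i y. min (g i y) (f (x, y))"] mC by simp
    \<comment> \<open>Three errors add up: \<open>N * e\<close> from truncating \<open>g i\<close>,
      \<open>e\<close> from the choice of \<open>g i\<close>, and \<open>e\<close> from moving
      \<open>h\<close> between \<open>i\<close> and \<open>x\<close>.\<close>
    have close: "\<bar>\<nu> (\<lambda>y. min (g i y) (f (x, y))) - h x\<bar> \<le> (N + 2) * e" if "x \<in> U i" for i x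
    proof -
      have fi: "\<bar>f (x, y) - f (i, y)\<bar> \<le> e" for y using U that by blast
      have hi: "\<bar>h x - h i\<bar> \<le> e" using U that by blast
      have gi: "0 \<le> g i y" "g i y \<le> f (i, y)" for y using g by auto
      have "\<bar>\<nu> (\<lambda>y. min (g i y) (f (x, y)) - g i y)\<bar> \<le> N * e"
      proof (rule N(2))
        show "tsupp (\<lambda>y. min (g i y) (f (x, y)) - g i y) \<subseteq> ?L"
        proof (rule tsupp_minimal[OF L(2)])
          fix y assume "y \<notin> ?L"
          then have "f (x, y) = 0" "f (i, y) = 0" by (rule section_eq_0)+
          then show "min (g i y) (f (x, y)) - g i y = 0" using gi[of y] by simp
        qed
        fix y show "\<bar>min (g i y) (f (x, y)) - g i y\<bar> \<le> e"
          using fi[of y] gi[of y] e by (auto simp: min_def abs_if split: if_splits)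
      qed (use mC gC in auto)
      then have "\<bar>\<nu> (\<lambda>y. min (g i y) (f (x, y))) - \<nu> (g i)\<bar> \<le> N * e"
        using linear_rm_diff[OF l(1) mC gC] by simp
      moreover have "\<bar>\<nu> (g i) - h i\<bar> \<le> e" using g by simp
      ultimately show ?thesis using hi by (simp add: distrib_right)
    qed
    define H where "H = (\<lambda>x. \<nu> (\<lambda>y. k (x, y)))"
    have HC: "H \<in> Cc" unfolding H_def by (rule Cc_partial_integral[OF kC \<nu>])
    have out: "H x - h x = 0" if "x \<notin> ?K" for x
    proof -
      have "k (x, y) = 0" for y using k0[of "(x, y)"] kf[of "(x, y)"] section_eq_0(1)[OF that] by (simp add: antisym)
      then have "H x = 0" unfolding H_def using linear_rm_zero[OF l(1)] by simp
      moreover have "h x = 0" using h(2,3)[of x] GK[OF that] by simp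
      ultimately show ?thesis by simp
    qed
    have "\<bar>H x - h x\<bar> \<le> (N + 2) * e" for x
    proof (cases "x \<in> ?K")
      case True
      then show ?thesis unfolding H_def k\<nu>
        using \<psi> close by (intro abs_convex_comb_le) auto
    next
      case False
      then show ?thesis using out[OF False] N(1) e by simp
    qed
    then have "\<bar>\<nu> (\<lambda>x. H x - h x)\<bar> \<le> M * ((N + 2) * e)"
      using HC h(1) out by (intro M(2) tsupp_minimal[OF K(2)]) auto
    moreover have "M * ((N + 2) * e) \<le> d"
    proof -
      have "M * ((N + 2) * e) = M * (N + 2) * d / (M * (N + 2) + 1)" unfolding e_def by simp
      also have "\<dots> \<le> d" using MN d by (simp add: divide_le_eq)
      finally show ?thesis .
    qed
    ultimately have "\<nu> h \<le> \<nu> H + d" using linear_rm_diff[OF l(1) HC h(1)] by simp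
    also have "\<nu> H = tensor \<nu> \<nu> k" using kC by (simp add: tensor_def H_def)
    also have "\<dots> \<le> pos_part (tensor \<nu> \<nu>) f"
      unfolding pos_part_eq_nonneg[OF lt f] by (rule pos_part_nonneg_upper[OF lt f(1) kC k0 kf])
    finally show "\<nu> h \<le> pos_part (tensor \<nu> \<nu>) f + d" by simp
  qed
  have "tensor (pos_part \<nu>) (pos_part \<nu>) f = pos_part \<nu> G" using f(1) by (simp add: tensor_def G_def)
  also have "\<dots> \<le> pos_part (tensor \<nu> \<nu>) f"
    unfolding pos_part_eq_nonneg[OF l G G0] by (rule pos_part_nonneg_least[OF l G0 main])
  finally show ?thesis .
qed

section \<open>The energy form\<close>

locale perfect_lc_kernel =
  fixes \<kappa> :: "'a::t2_space \<Rightarrow> 'a \<Rightarrow> ereal"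
  assumes lc: "locally_compact_space (euclidean :: 'a topology)"
    and perfect: "perfect_kernel \<kappa>"
begin

definition minorants :: "('a \<times> 'a \<Rightarrow> real) set" where
  "minorants = {f\<in>Cc. \<forall>z. ereal (f z) \<le> \<kappa> (fst z) (snd z)}"

definition J :: "('a \<times> 'a) rmeas \<Rightarrow> ereal" where
  "J A = (SUP f\<in>minorants. ereal (A f))"

text \<open>An infinite integral is sent to 0, so the value is meaningful only where
  \<open>J\<close> is finite, as it is for two elements of \<open>Ep\<close>.\<close>

definition mutual :: "'a rmeas \<Rightarrow> 'a rmeas \<Rightarrow> real" where
  "mutual a b = real_of_ereal (J (tensor a b))"

lemma lsc_integral_eq_J: "lsc_integral A (\<lambda>z. \<kappa> (fst z) (snd z)) = J A"
  by (simp add: lsc_integral_def J_def minorants_def)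

lemma kernel: "kernel \<kappa>"
  using perfect by (simp add: perfect_kernel_def)

lemma minorants_Cc: "f \<in> minorants \<Longrightarrow> f \<in> Cc"
  by (simp add: minorants_def)

lemma minorants_max: "f \<in> minorants \<Longrightarrow> g \<in> minorants \<Longrightarrow> (\<lambda>z. max (f z) (g z)) \<in> minorants"
  by (simp add: minorants_def)

lemma zero_minorant: "\<not> compact (UNIV :: 'a set) \<Longrightarrow> (\<lambda>z. 0) \<in> minorants"
proof -
  assume n: "\<not> compact (UNIV :: 'a set)"
  have "\<not> compact (UNIV :: ('a \<times> 'a) set)"
  proof
    assume "compact (UNIV :: ('a \<times> 'a) set)"
    then have "compact (fst ` (UNIV :: ('a \<times> 'a) set))"
      by (intro compact_continuous_image continuous_intros)
    then show False using n by simp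
  qed
  then show ?thesis using kernel by (simp add: minorants_def kernel_def zero_ereal_def)
qed

text \<open>This keeps \<open>J\<close> away from -\<infinity>. On a compact space the open sets
  where the kernel exceeds -n cover the product, so finitely many of them do; the kernel is then
  bounded below by a constant, which has compact support.\<close>

lemma minorants_nonempty: "minorants \<noteq> {}"
proof (cases "compact (UNIV :: 'a set)")
  case True
  then have comp: "compact (UNIV :: ('a \<times> 'a) set)"
    using compact_Times[OF True True] by simp
  let ?O = "\<lambda>n::nat. {z::'a\<times>'a. ereal (- real n) < \<kappa> (fst z) (snd z)}"
  have "\<exists>n. z \<in> ?O n" for z :: "'a \<times> 'a"
  proof (cases "\<kappa> (fst z) (snd z)")
    case (real r)
    obtain n :: nat where "- r < real n" using reals_Archimedean2 by blast
    then show ?thesis using real by (intro exI[of _ n]) simp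
  next
    case PInf
    then show ?thesis by simp
  next
    case MInf
    then show ?thesis using kernel by (simp add: kernel_def)
  qed
  then have cover: "UNIV \<subseteq> (\<Union>n\<in>UNIV. ?O n)" by auto
  have "open (?O n)" for n
    using kernel unfolding kernel_def by blast
  then obtain I where I: "I \<subseteq> UNIV" "finite I" "UNIV \<subseteq> (\<Union>n\<in>I. ?O n)"
    by (rule compactE_image[OF comp _ cover])
  define c where "c = - real (Max (insert 0 I))"
  have "ereal c \<le> \<kappa> (fst z) (snd z)" for z :: "'a \<times> 'a"
  proof -
    obtain n where n: "n \<in> I" "ereal (- real n) < \<kappa> (fst z) (snd z)" using I(3) by blast
    have "c \<le> - real n" unfolding c_def using n(1) I(2) by simp
    then show ?thesis using n(2) by (meson ereal_less_eq(3) less_imp_le order_trans)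
  qed
  moreover have "(\<lambda>z::'a \<times> 'a. c) \<in> Cc" using comp by (intro CcI[of _ UNIV]) auto
  ultimately have "(\<lambda>z. c) \<in> minorants" unfolding minorants_def by blast
  then show ?thesis by blast
next
  case False
  then show ?thesis using zero_minorant by blast
qed

lemma J_upper: "f \<in> minorants \<Longrightarrow> ereal (A f) \<le> J A"
  unfolding J_def by (rule SUP_upper)

lemma J_not_MInf: "J A \<noteq> - \<infinity>"
proof -
  obtain f where "f \<in> minorants" using minorants_nonempty by blast
  then show ?thesis using J_upper[of f A] by auto
qed

lemma J_zero: "J (\<lambda>f. 0) = 0"
  unfolding J_def using minorants_nonempty by (simp flip: zero_ereal_def)

text \<open>The maximum of two minorants is a minorant, so a single one can approach both suprema.
  Fixing \<open>f\<close> and taking the supremum over \<open>g\<close> first avoids adding two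
  extended suprema.\<close>

lemma J_plus:
  assumes A: "poslin_rm A" and B: "poslin_rm B"
  shows "J (A + B) = J A + J B"
proof (rule antisym)
  show "J (A + B) \<le> J A + J B"
    unfolding J_def[of "A + B"]
  proof (rule SUP_least)
    fix f assume f: "f \<in> minorants"
    show "ereal ((A + B) f) \<le> J A + J B"
      using add_mono[OF J_upper[OF f, of A] J_upper[OF f, of B]] by simp
  qed
  show "J A + J B \<le> J (A + B)"
  proof (cases "J (A + B)")
    case (real r)
    have fg: "A f + B g \<le> r" if f: "f \<in> minorants" and g: "g \<in> minorants" for f g
    proof -
      let ?m = "\<lambda>z. max (f z) (g z)"
      have "?m \<in> Cc" using minorants_Cc[OF minorants_max[OF f g]] .
      then have "A f \<le> A ?m" "B g \<le> B ?m"
        using f g by (auto intro!: poslin_rm_mono[OF A] poslin_rm_mono[OF B] minorants_Cc)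
      moreover have "ereal ((A + B) ?m) \<le> ereal r" using J_upper[OF minorants_max[OF f g], of "A + B"] real by simp
      ultimately show ?thesis by simp
    qed
    have B': "J B \<le> ereal (r - A f)" if f: "f \<in> minorants" for f
      unfolding J_def[of B] using fg[OF f] by (intro SUP_least) (simp add: algebra_simps)
    obtain f where f: "f \<in> minorants" using minorants_nonempty by blast
    obtain b where b: "J B = ereal b" using B'[OF f] J_not_MInf[of B] by (cases "J B") auto
    have "J A \<le> ereal (r - b)"
      unfolding J_def[of A] using B' b by (intro SUP_least) (simp add: algebra_simps)
    then show ?thesis using b real J_not_MInf[of A] by (cases "J A") auto
  qed (use J_not_MInf in auto)
qed

lemma J_scale:
  assumes "0 \<le> c" "J A \<noteq> \<infinity>"
  shows "J (\<lambda>f. c * A f) = ereal (c * real_of_ereal (J A))"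
proof (cases "c = 0")
  case True
  then show ?thesis using J_zero by (simp flip: zero_ereal_def)
next
  case False
  then have c: "0 < c" using assms by simp
  \<comment> \<open>Used twice: with factor \<open>c\<close> for \<kappa> against \<open>A\<close>,
    and with factor \<open>1 / c\<close> against the scaled functional for the reverse
    inequality.\<close>
  have le: "J (\<lambda>f. c * A f) \<le> ereal (c * r)" if "0 < c" "J A = ereal r" for A c r
    unfolding J_def[of "\<lambda>f. c * A f"] using that J_upper[of _ A] by (intro SUP_least) auto
  obtain r where r: "J A = ereal r" using assms(2) J_not_MInf[of A] by (cases "J A") auto
  obtain s where s: "J (\<lambda>f. c * A f) = ereal s"
    using le[OF c r] J_not_MInf[of "\<lambda>f. c * A f"] by (cases "J (\<lambda>f. c * A f)") auto
  have "ereal r \<le> ereal ((1 / c) * s)"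
    using le[OF _ s, of "1 / c"] c r by simp
  then show ?thesis using le[OF c r] r s c by (simp add: field_simps)
qed

lemma J_plus_finite:
  assumes "poslin_rm A" "poslin_rm B"
  shows "J (A + B) \<noteq> \<infinity> \<longleftrightarrow> J A \<noteq> \<infinity> \<and> J B \<noteq> \<infinity>"
  unfolding J_plus[OF assms] using J_not_MInf[of A] J_not_MInf[of B] by (cases "J A"; cases "J B") auto

lemma real_J_plus:
  assumes "poslin_rm A" "poslin_rm B" "J A \<noteq> \<infinity>" "J B \<noteq> \<infinity>"
  shows "real_of_ereal (J (A + B)) = real_of_ereal (J A) + real_of_ereal (J B)"
  unfolding J_plus[OF assms(1,2)] using assms J_not_MInf[of A] J_not_MInf[of B] by (cases "J A"; cases "J B") auto

lemma ereal_real_J: "J A \<noteq> \<infinity> \<Longrightarrow> ereal (real_of_ereal (J A)) = J A"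
  using J_not_MInf[of A] by (cases "J A") auto

section \<open>Finite energy: the cone of positive measures and its differences\<close>

definition Ep :: "'a rmeas set" where
  "Ep = {a. poslin_rm a \<and> J (tensor a a) \<noteq> \<infinity>}"

lemma poslin_radon: "poslin_rm a \<Longrightarrow> real_radon (a :: 'a rmeas)"
  by (rule poslin_rm_real_radon[OF lc])

lemma poslin_tensor': "poslin_rm a \<Longrightarrow> poslin_rm b \<Longrightarrow> poslin_rm (tensor a (b :: 'a rmeas))"
  by (rule poslin_tensor[OF poslin_radon poslin_radon])

lemma Ep_poslin: "a \<in> Ep \<Longrightarrow> poslin_rm a"
  by (simp add: Ep_def)

lemma tensor_minus_minus:
  fixes a b :: "'a rmeas"
  assumes "real_radon a" "real_radon b"
  shows "tensor (a - b) (a - b) = (tensor a a + tensor b b) - (tensor a b + tensor b a)"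
  using assms real_radon_minus[OF assms] by (simp add: tensor_minus_left tensor_minus_right algebra_simps)

text \<open>Split the tensor square of \<open>a - b\<close> as \<open>A - B\<close>, with the pure
  terms in \<open>A\<close> and the mixed ones in \<open>B\<close>. Its Jordan parts satisfy
  \<open>A = P + C\<close> and \<open>B = N + C\<close> with the same positive \<open>C\<close>.
  Additivity of \<open>J\<close> makes \<open>P\<close> and \<open>C\<close> finite; positivity of
  the energy then makes \<open>N\<close> finite, and with it \<open>B\<close>.\<close>

lemma energy_minus:
  assumes a: "a \<in> Ep" and b: "b \<in> Ep"
  shows "J (tensor a b) \<noteq> \<infinity>" "J (tensor b a) \<noteq> \<infinity>"
    "energy_defined \<kappa> (a - b) (a - b)"
    "energy \<kappa> (a - b) (a - b) = ereal (mutual a a + mutual b b - mutual a b - mutual b a)"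
proof -
  note p = Ep_poslin[OF a] Ep_poslin[OF b]
  note r = p[THEN poslin_radon]
  define A where "A = tensor a a + tensor b b"
  define B where "B = tensor a b + tensor b a"
  have A: "poslin_rm A" unfolding A_def
    by (rule poslin_rm_plus[OF poslin_tensor'[OF p(1,1)] poslin_tensor'[OF p(2,2)]])
  have B: "poslin_rm B" unfolding B_def
    by (rule poslin_rm_plus[OF poslin_tensor'[OF p] poslin_tensor'[OF p(2,1)]])
  have lam: "tensor (a - b) (a - b) = A - B" unfolding A_def B_def using r by (rule tensor_minus_minus)
  define P where "P = pos_part (A - B)"
  define N where "N = neg_part (A - B)"
  have l: "linear_rm (A - B)" "order_bounded_rm (A - B)"
    using A B by (auto intro!: linear_rm_minus order_bounded_minus dest: poslin_rmD)
  have P: "poslin_rm P" and N: "poslin_rm N" unfolding P_def N_def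
    using poslin_pos_part[OF l] poslin_neg_part[OF l] by auto
  define C where "C = A - P"
  have C: "poslin_rm C"
    unfolding C_def using A P pos_part_minus_le[OF A B] unfolding P_def
    by (intro poslin_rm_minus) (auto dest: poslin_rmD)
  have "A = P + C" by (simp add: C_def)
  then have AJ: "J A = J P + J C" using J_plus[OF P C] by simp
  have "B = N + C" unfolding N_def neg_part_eq[OF l] C_def P_def by (simp add: algebra_simps)
  then have BJ: "J B = J N + J C" using J_plus[OF N C] by simp
  have Afin: "J A \<noteq> \<infinity>" unfolding A_def using a b p poslin_tensor'
    by (subst J_plus_finite) (auto simp: Ep_def)
  then have fin: "J P \<noteq> \<infinity>" "J C \<noteq> \<infinity>" using AJ J_not_MInf[of P] J_not_MInf[of C] by auto
  have en: "energy \<kappa> (a - b) (a - b) = J P - J N"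
    by (simp add: energy_def energy_pos_def energy_neg_def lsc_integral_eq_J lam P_def N_def)
  show d: "energy_defined \<kappa> (a - b) (a - b)"
    using fin(1) by (simp add: energy_defined_def energy_pos_def lsc_integral_eq_J lam P_def)
  have "0 \<le> energy \<kappa> (a - b) (a - b)"
    using perfect d real_radon_minus[OF r] by (simp add: perfect_kernel_def)
  then have finN: "J N \<noteq> \<infinity>" using en fin J_not_MInf[of P] by (cases "J P") auto
  then have "J B \<noteq> \<infinity>" using BJ fin by simp
  then show fin': "J (tensor a b) \<noteq> \<infinity>" "J (tensor b a) \<noteq> \<infinity>"
    unfolding B_def using J_plus_finite[of "tensor a b" "tensor b a"] p poslin_tensor' by auto
  have "J P - J N = ereal (real_of_ereal (J A) - real_of_ereal (J B))"
    using fin finN AJ BJ J_not_MInf[of P] J_not_MInf[of C] J_not_MInf[of N]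
    by (cases "J P"; cases "J C"; cases "J N") auto
  also have "real_of_ereal (J A) = mutual a a + mutual b b"
    unfolding A_def mutual_def using a b p by (intro real_J_plus poslin_tensor') (auto simp: Ep_def)
  also have "real_of_ereal (J B) = mutual a b + mutual b a"
    unfolding B_def mutual_def using fin' p by (intro real_J_plus poslin_tensor') auto
  finally show "energy \<kappa> (a - b) (a - b) = ereal (mutual a a + mutual b b - mutual a b - mutual b a)"
    using en by (simp add: algebra_simps)
qed

lemma Emeas_minus: "a \<in> Ep \<Longrightarrow> b \<in> Ep \<Longrightarrow> a - b \<in> Emeas \<kappa>"
  using energy_minus[of a b] real_radon_minus[OF poslin_radon poslin_radon, of a b]
  by (simp add: Emeas_def Ep_poslin)

lemma zero_Ep: "(\<lambda>f. 0) \<in> Ep"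
proof -
  have "tensor (\<lambda>f. 0) (\<lambda>f. 0) = (\<lambda>f::'a \<times> 'a \<Rightarrow> real. 0)" by (auto simp: tensor_def)
  then show ?thesis using J_zero poslin_rm_zero by (simp add: Ep_def)
qed

lemma Ep_subset_Emeas: "Ep \<subseteq> Emeas \<kappa>"
  using Emeas_minus[OF _ zero_Ep] by (force simp: fun_diff_def)

lemma Emeas_energy_pos_finite: "\<nu> \<in> Emeas \<kappa> \<Longrightarrow> J (pos_part (tensor \<nu> \<nu>)) \<noteq> \<infinity>"
proof -
  assume \<nu>: "\<nu> \<in> Emeas \<kappa>"
  let ?P = "J (pos_part (tensor \<nu> \<nu>))" and ?N = "J (neg_part (tensor \<nu> \<nu>))"
  have "\<not> (?P = \<infinity> \<and> ?N = \<infinity>)" "\<bar>?P - ?N\<bar> \<noteq> \<infinity>"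
    using \<nu> by (auto simp: Emeas_def energy_defined_def energy_def energy_pos_def energy_neg_def lsc_integral_eq_J)
  then show ?thesis by (cases ?P; cases ?N) auto
qed

text \<open>For positive \<open>a\<close> the functional \<open>tensor a a\<close> is its own
  positive part, so the Jordan parts disappear from the definition of the energy.\<close>

lemma Emeas_pos_eq: "Emeas_pos \<kappa> = Ep"
proof (intro set_eqI iffI)
  fix a assume a: "a \<in> Emeas_pos \<kappa>"
  then have p: "poslin_rm a"
    using real_radon_linear by (auto simp: Emeas_pos_def Emeas_def poslin_rm_def)
  show "a \<in> Ep"
    using Emeas_energy_pos_finite[of a] a p pos_part_poslin[OF poslin_tensor'[OF p p]]
    by (simp add: Ep_def Emeas_pos_def)
next
  fix a assume "a \<in> Ep"
  then show "a \<in> Emeas_pos \<kappa>" using Ep_subset_Emeas by (auto simp: Emeas_pos_def Ep_def poslin_rm_def)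
qed

lemma Emeas_decomp:
  assumes \<nu>: "\<nu> \<in> Emeas \<kappa>"
  obtains a b where "a \<in> Ep" "b \<in> Ep" "\<nu> = a - b"
proof -
  have r: "real_radon \<nu>" using \<nu> by (simp add: Emeas_def)
  note l = real_radon_linear[OF r] real_radon_order_bounded[OF r]
  have eq: "\<nu> = pos_part \<nu> - neg_part \<nu>" using neg_part_eq[OF l] by simp
  have p: "poslin_rm (pos_part \<nu>)" "poslin_rm (neg_part \<nu>)"
    using poslin_pos_part[OF l] poslin_neg_part[OF l] by auto
  \<comment> \<open>Before the Jordan parts of \<nu> \<otimes> \<nu> can be used, it must be order
    bounded; expanding the Jordan decomposition of \<nu> exhibits it as a difference of positive
    functionals.\<close>
  have "order_bounded_rm (tensor (pos_part \<nu> - neg_part \<nu>) (pos_part \<nu> - neg_part \<nu>))"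
    unfolding tensor_minus_minus[OF p[THEN poslin_radon]]
    by (intro order_bounded_minus poslin_rm_plus poslin_tensor' p)
  then have bd: "order_bounded_rm (tensor \<nu> \<nu>)" using eq by simp
  note P = poslin_pos_part[OF linear_tensor[OF r r] bd]
  \<comment> \<open>\<open>J\<close> need not be monotone when the kernel takes negative values.
    Finiteness passes to the smaller functional through additivity, the majorant being
    \<open>tensor a a\<close> plus a positive remainder.\<close>
  have dom: "J (tensor a a) \<noteq> \<infinity>"
    if a: "poslin_rm a" and le: "\<And>f. f \<in> Cc \<Longrightarrow> (\<And>x. 0 \<le> f x) \<Longrightarrow> tensor a a f \<le> pos_part (tensor \<nu> \<nu>) f" for a
  proof -
    note t = poslin_tensor'[OF a a]
    have m: "poslin_rm (pos_part (tensor \<nu> \<nu>) - tensor a a)"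
      by (rule poslin_rm_minus[OF poslin_rmD[OF P] poslin_rmD[OF t] le])
    have "J (tensor a a + (pos_part (tensor \<nu> \<nu>) - tensor a a)) \<noteq> \<infinity>"
      using Emeas_energy_pos_finite[OF \<nu>] by simp
    then show ?thesis using J_plus_finite[OF t m] by simp
  qed
  have neg: "real_radon (- \<nu>)"
    using real_radon_minus[OF poslin_radon[OF poslin_rm_zero] r] by (simp add: fun_diff_def fun_Compl_def)
  \<comment> \<open>Since - \<nu> has the same tensor square, the estimate for positive parts also
    covers the negative part of \<nu>.\<close>
  have tn: "tensor (- \<nu>) (- \<nu>) = tensor \<nu> \<nu>"
    using tensor_scale_left[of "-1" \<nu>] tensor_scale_right[OF r r, of "-1"] neg
      tensor_scale_left[of "-1" \<nu> "- \<nu>"] by (simp add: fun_Compl_def)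
  have "tensor (pos_part \<nu>) (pos_part \<nu>) f \<le> pos_part (tensor \<nu> \<nu>) f" if "f \<in> Cc" "\<And>x. 0 \<le> f x" for f
    by (rule tensor_pos_part_le[OF lc r bd that])
  then have "pos_part \<nu> \<in> Ep" using dom p by (simp add: Ep_def)
  moreover have "tensor (neg_part \<nu>) (neg_part \<nu>) f \<le> pos_part (tensor \<nu> \<nu>) f" if "f \<in> Cc" "\<And>x. 0 \<le> f x" for f
    using tensor_pos_part_le[OF lc neg _ that] bd unfolding tn neg_part_def by simp
  then have "neg_part \<nu> \<in> Ep" using dom p by (simp add: Ep_def)
  ultimately show ?thesis using that eq by blast
qed

lemma Ep_mutual_finite: "a \<in> Ep \<Longrightarrow> b \<in> Ep \<Longrightarrow> J (tensor a b) \<noteq> \<infinity>"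
  using energy_minus(1) .

lemma Ep_plus:
  assumes "a \<in> Ep" "b \<in> Ep"
  shows "a + b \<in> Ep"
proof -
  note p = assms[THEN Ep_poslin]
  note r = p[THEN poslin_radon]
  have "tensor (a + b) (a + b) = (tensor a a + tensor a b) + (tensor b a + tensor b b)"
    using r poslin_radon[OF poslin_rm_plus[OF p]] by (simp add: tensor_plus_left tensor_plus_right)
  moreover have "J ((tensor a a + tensor a b) + (tensor b a + tensor b b)) \<noteq> \<infinity>"
    using assms by (simp add: J_plus_finite poslin_rm_plus poslin_tensor' p Ep_mutual_finite)
  ultimately show ?thesis using poslin_rm_plus[OF p] by (simp add: Ep_def)
qed

lemma mutual_plus_left:
  assumes "a \<in> Ep" "b \<in> Ep" "c \<in> Ep"
  shows "mutual (a + b) c = mutual a c + mutual b c"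
  unfolding mutual_def tensor_plus_left
  using assms by (intro real_J_plus poslin_tensor' Ep_poslin Ep_mutual_finite)

lemma mutual_plus_right:
  assumes "a \<in> Ep" "b \<in> Ep" "c \<in> Ep"
  shows "mutual a (b + c) = mutual a b + mutual a c"
  unfolding mutual_def tensor_plus_right[OF assms[THEN Ep_poslin, THEN poslin_radon]]
  using assms by (intro real_J_plus poslin_tensor' Ep_poslin Ep_mutual_finite)

lemma mutual_scale_left:
  assumes "a \<in> Ep" "b \<in> Ep" "0 \<le> c"
  shows "mutual (\<lambda>f. c * a f) b = c * mutual a b"
  unfolding mutual_def tensor_scale_left using J_scale[OF assms(3) Ep_mutual_finite[OF assms(1,2)]] by simp

lemma mutual_scale_right:
  assumes "a \<in> Ep" "b \<in> Ep" "0 \<le> c"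
  shows "mutual a (\<lambda>f. c * b f) = c * mutual a b"
  unfolding mutual_def tensor_scale_right[OF assms(1,2)[THEN Ep_poslin, THEN poslin_radon]]
  using J_scale[OF assms(3) Ep_mutual_finite[OF assms(1,2)]] by simp

lemma Ep_scale:
  assumes "a \<in> Ep" "0 \<le> c"
  shows "(\<lambda>f. c * a f) \<in> Ep"
proof -
  note p = poslin_rm_scale[OF Ep_poslin[OF assms(1)] assms(2)]
  have "tensor (\<lambda>f. c * a f) (\<lambda>f. c * a f) = (\<lambda>f. c\<^sup>2 * tensor a a f)"
    using tensor_scale_left[of c a] tensor_scale_right[of a a c] poslin_radon[OF Ep_poslin[OF assms(1)]]
    by (simp add: power2_eq_square mult.assoc)
  then show ?thesis using p J_scale[of "c\<^sup>2" "tensor a a"] Ep_mutual_finite[OF assms(1,1)]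
    by (simp add: Ep_def)
qed

section \<open>The energy as a quadratic form and its norm\<close>

definition Q :: "'a rmeas \<Rightarrow> real" where
  "Q x = real_of_ereal (energy \<kappa> x x)"

lemma Q_minus:
  "a \<in> Ep \<Longrightarrow> b \<in> Ep \<Longrightarrow> Q (a - b) = mutual a a + mutual b b - mutual a b - mutual b a"
  using energy_minus(4)[of a b] by (simp add: Q_def)

lemma Q_Ep: "a \<in> Ep \<Longrightarrow> Q a = mutual a a"
  using Q_minus[OF _ zero_Ep, of a] mutual_scale_left[OF _ _ order_refl] mutual_scale_right[OF _ _ order_refl]
    zero_Ep by (simp add: fun_diff_def)

text \<open>A difference of differences regroups as \<open>(a + d) - (b + c)\<close>, and
  \<open>Ep\<close> is closed under addition because mutual energies are finite.\<close>

lemma Emeas_diff: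
  assumes "x \<in> Emeas \<kappa>" "y \<in> Emeas \<kappa>"
  shows "x - y \<in> Emeas \<kappa>"
proof -
  obtain a b where x: "a \<in> Ep" "b \<in> Ep" "x = a - b" by (rule Emeas_decomp[OF assms(1)])
  obtain c d where y: "c \<in> Ep" "d \<in> Ep" "y = c - d" by (rule Emeas_decomp[OF assms(2)])
  have "x - y = (a + d) - (b + c)" using x y by simp
  then show ?thesis using Emeas_minus[OF Ep_plus[OF x(1) y(2)] Ep_plus[OF x(2) y(1)]] by simp
qed

lemma Q_scale:
  assumes "x \<in> Emeas \<kappa>" "0 \<le> c"
  shows "(\<lambda>f. c * x f) \<in> Emeas \<kappa>" "Q (\<lambda>f. c * x f) = c\<^sup>2 * Q x"
proof -
  obtain a b where x: "a \<in> Ep" "b \<in> Ep" "x = a - b" by (rule Emeas_decomp[OF assms(1)])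
  have eq: "(\<lambda>f. c * x f) = (\<lambda>f. c * a f) - (\<lambda>f. c * b f)"
    using x by (auto simp: fun_eq_iff right_diff_distrib)
  note s = Ep_scale[OF x(1) assms(2)] Ep_scale[OF x(2) assms(2)]
  show "(\<lambda>f. c * x f) \<in> Emeas \<kappa>" unfolding eq by (rule Emeas_minus[OF s])
  show "Q (\<lambda>f. c * x f) = c\<^sup>2 * Q x"
    unfolding eq Q_minus[OF s] unfolding x(3) Q_minus[OF x(1,2)] using x(1,2) s assms(2)
    by (simp add: mutual_scale_left mutual_scale_right power2_eq_square algebra_simps)
qed

lemma Q_nonneg: "x \<in> Emeas \<kappa> \<Longrightarrow> 0 \<le> Q x"
  using perfect by (auto simp: Q_def perfect_kernel_def Emeas_def intro!: real_of_ereal_pos)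

lemma Q_eq_0: "x \<in> Emeas \<kappa> \<Longrightarrow> Q x = 0 \<Longrightarrow> x = (\<lambda>f. 0)"
  using perfect by (auto simp: Q_def perfect_kernel_def Emeas_def real_of_ereal_eq_0)

lemma enorm_eq: "enorm \<kappa> x = sqrt (Q x)"
  by (simp add: enorm_def Q_def)

lemma enorm_sq: "x \<in> Emeas \<kappa> \<Longrightarrow> (enorm \<kappa> x)\<^sup>2 = Q x"
  by (simp add: enorm_eq Q_nonneg)

lemma enorm_nonneg: "x \<in> Emeas \<kappa> \<Longrightarrow> 0 \<le> enorm \<kappa> x"
  by (simp add: enorm_eq Q_nonneg)

text \<open>The bracket is twice the inner product of \<open>x\<close> and \<open>y\<close>,
  expressed through \<open>Q\<close>. The value \<open>t = 1\<close> gives the parallelogram law, a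
  suitable other \<open>t\<close> the Cauchy-Schwarz inequality.\<close>

lemma Q_minus_scale:
  assumes x: "x \<in> Emeas \<kappa>" and y: "y \<in> Emeas \<kappa>" and t: "0 \<le> t"
  shows "Q (x - (\<lambda>f. t * y f)) = Q x - t * (Q (x + y) - Q x - Q y) + t\<^sup>2 * Q y"
proof -
  obtain a b where ab: "a \<in> Ep" "b \<in> Ep" "x = a - b" by (rule Emeas_decomp[OF x])
  obtain c d where cd: "c \<in> Ep" "d \<in> Ep" "y = c - d" by (rule Emeas_decomp[OF y])
  let ?c = "\<lambda>f. t * c f" and ?d = "\<lambda>f. t * d f"
  note s = Ep_scale[OF cd(1) t] Ep_scale[OF cd(2) t]
  have e1: "x - (\<lambda>f. t * y f) = (a + ?d) - (b + ?c)"
    using ab(3) cd(3) by (auto simp: fun_eq_iff right_diff_distrib)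
  have e2: "x + y = (a + c) - (b + d)" using ab(3) cd(3) by simp
  show ?thesis
    unfolding e1 e2 Q_minus[OF Ep_plus[OF ab(1) s(2)] Ep_plus[OF ab(2) s(1)]]
      Q_minus[OF Ep_plus[OF ab(1) cd(1)] Ep_plus[OF ab(2) cd(2)]]
    unfolding ab(3) cd(3) Q_minus[OF ab(1,2)] Q_minus[OF cd(1,2)]
    using ab(1,2) cd(1,2) s t
    by (simp add: mutual_plus_left mutual_plus_right Ep_plus mutual_scale_left mutual_scale_right
        power2_eq_square algebra_simps)
qed

lemma parallelogram:
  assumes "x \<in> Emeas \<kappa>" "y \<in> Emeas \<kappa>"
  shows "Q (x + y) + Q (x - y) = 2 * Q x + 2 * Q y"
  using Q_minus_scale[OF assms, of 1] by simp

lemma enorm_triangle: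
  assumes x: "x \<in> Emeas \<kappa>" and y: "y \<in> Emeas \<kappa>"
  shows "enorm \<kappa> (x + y) \<le> enorm \<kappa> x + enorm \<kappa> y"
proof -
  let ?u = "enorm \<kappa> x" and ?v = "enorm \<kappa> y"
  have uv: "0 \<le> ?u" "0 \<le> ?v" using enorm_nonneg x y by auto
  have "Q (x + y) \<le> (?u + ?v)\<^sup>2"
  \<comment> \<open>An element of norm 0 vanishes by strict positive definiteness. In the other case
    both norms may serve as divisors.\<close>
  proof (cases "?u = 0 \<or> ?v = 0")
    case True
    from True show ?thesis
    proof
      assume u: "?u = 0"
      then have "x = (\<lambda>f. 0)" by (intro Q_eq_0[OF x]) (simp add: enorm_eq)
      then have "x + y = y" by (simp add: plus_fun_def)
      then show ?thesis using u enorm_sq[OF y] by simp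
    next
      assume v: "?v = 0"
      then have "y = (\<lambda>f. 0)" by (intro Q_eq_0[OF y]) (simp add: enorm_eq)
      then have "x + y = x" by (simp add: plus_fun_def)
      then show ?thesis using v enorm_sq[OF x] by simp
    qed
  next
    case False
    then have p: "0 < ?u" "0 < ?v" using uv by auto
    \<comment> \<open>For this \<open>t\<close> the elements \<open>x\<close> and \<open>t y\<close>
      have equal norm, and nonnegativity of \<open>Q (x - t y)\<close> becomes the upper half of
      Cauchy-Schwarz, \<open>S \<le> 2 * ?u * ?v\<close>.\<close>
    define t where "t = ?u / ?v"
    have t: "0 < t" "t * ?v = ?u" using p by (auto simp: t_def)
    define S where "S = Q (x + y) - Q x - Q y"
    have "0 \<le> Q (x - (\<lambda>f. t * y f))"
      using x y t by (intro Q_nonneg Emeas_diff Q_scale) auto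
    also have "\<dots> = ?u\<^sup>2 - t * S + t\<^sup>2 * ?v\<^sup>2"
      using Q_minus_scale[OF x y less_imp_le[OF t(1)]] enorm_sq[OF x] enorm_sq[OF y] by (simp add: S_def)
    also have "t\<^sup>2 * ?v\<^sup>2 = ?u\<^sup>2" using t(2) by (simp flip: power_mult_distrib)
    finally have "t * S \<le> 2 * ?u\<^sup>2" by simp
    also have "\<dots> = t * (2 * ?u * ?v)" using t(2) by (simp add: power2_eq_square mult.assoc mult.commute)
    finally have "S \<le> 2 * ?u * ?v" using t(1) by simp
    then show ?thesis using enorm_sq[OF x] enorm_sq[OF y] by (simp add: power2_sum S_def)
  qed
  then show ?thesis using uv by (simp add: enorm_eq[of "x + y"] real_le_lsqrt)
qed

end

section \<open>Vague compactness, projections and approximation by compact sets\<close>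

text \<open>Tychonoff: the functionals lie in a product of compact intervals, one for each function,
  reduced to 0 off \<open>Cc\<close> in accordance with the normalisation. Linearity and positivity
  survive pointwise limits.\<close>

lemma vague_compact:
  fixes \<Phi> :: "'a::t2_space rmeas filter"
  assumes \<Phi>: "\<Phi> \<noteq> bot" and ev: "\<forall>\<^sub>F \<mu> in \<Phi>. poslin_rm \<mu> \<and> (\<forall>f\<in>Cc. \<bar>\<mu> f\<bar> \<le> C f)"
  obtains \<omega> G where "poslin_rm \<omega>" "G \<noteq> bot" "G \<le> \<Phi>" "\<forall>f. ((\<lambda>\<mu>. \<mu> f) \<longlongrightarrow> \<omega> f) G"
proof -
  define D where "D = (\<lambda>f. if f \<in> Cc then C f else 0)"
  define U where "U = PiE (UNIV :: ('a \<Rightarrow> real) set) (\<lambda>f. {- D f..D f})"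
  have "compactin (product_topology (\<lambda>i. euclidean) UNIV) U"
    unfolding U_def by (simp add: compactin_PiE)
  then have U: "compact U" by (simp add: euclidean_product_topology)
  have "\<forall>\<^sub>F \<mu> in \<Phi>. \<mu> \<in> U"
    using ev
  proof eventually_elim
    case (elim \<mu>)
    have "\<bar>\<mu> f\<bar> \<le> D f" for f
      using elim linear_rm_outside[OF poslin_rmD, of \<mu> f] by (auto simp: D_def)
    then show ?case by (auto simp: U_def abs_le_iff minus_le_iff)
  qed
  then obtain \<omega> where \<omega>: "inf (nhds \<omega>) \<Phi> \<noteq> bot"
    using U \<Phi> unfolding compact_filter by blast
  \<comment> \<open>This finer filter plays the role of a convergent subnet.\<close>
  define G where "G = inf (nhds \<omega>) \<Phi>"
  have G: "G \<noteq> bot" "G \<le> \<Phi>" "G \<le> nhds \<omega>" using \<omega> by (auto simp: G_def)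
  have lim: "((\<lambda>\<mu>. \<mu> f) \<longlongrightarrow> \<omega> f) G" for f
  proof -
    have "((\<lambda>\<mu>. \<mu> f) \<longlongrightarrow> \<omega> f) (nhds \<omega>)"
    proof (rule topological_tendstoI)
      fix S :: "real set" assume S: "open S" "\<omega> f \<in> S"
      have "open ((\<lambda>\<mu>::'a rmeas. \<mu> f) -` S)"
        by (rule open_vimage[OF S(1) continuous_on_product_coordinates])
      then show "\<forall>\<^sub>F \<mu> in nhds \<omega>. \<mu> f \<in> S" unfolding eventually_nhds using S(2) by blast
    qed
    then show ?thesis using G(3) tendsto_mono by blast
  qed
  have evG: "\<forall>\<^sub>F \<mu> in G. poslin_rm \<mu>"
    using filter_leD[OF G(2) ev] by eventually_elim simp
  have lin: "\<forall>\<^sub>F \<mu> in G. linear_rm \<mu>" using evG by eventually_elim (rule poslin_rmD)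
  have eq: "u = v" if "((\<lambda>\<mu>. p \<mu>) \<longlongrightarrow> u) G" "((\<lambda>\<mu>. q \<mu>) \<longlongrightarrow> v) G" "\<forall>\<^sub>F \<mu> in G. p \<mu> = q \<mu>"
    for p q :: "'a rmeas \<Rightarrow> real" and u v
    using tendsto_unique[OF G(1) that(1)] that(2,3) tendsto_cong[OF that(3)] by blast
  have "poslin_rm \<omega>"
    unfolding poslin_rm_def linear_rm_def positive_rm_def
  proof (intro conjI allI ballI impI)
    fix f :: "'a \<Rightarrow> real" assume f: "f \<notin> Cc"
    show "\<omega> f = 0"
    proof (rule eq[OF lim tendsto_const])
      show "\<forall>\<^sub>F \<mu> in G. \<mu> f = 0" using lin by eventually_elim (rule linear_rm_outside[OF _ f])
    qed
  next
    fix f g :: "'a \<Rightarrow> real" assume fg: "f \<in> Cc" "g \<in> Cc"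
    show "\<omega> (\<lambda>x. f x + g x) = \<omega> f + \<omega> g"
    proof (rule eq[OF lim tendsto_add[OF lim lim]])
      show "\<forall>\<^sub>F \<mu> in G. \<mu> (\<lambda>x. f x + g x) = \<mu> f + \<mu> g"
        using lin by eventually_elim (rule linear_rm_add[OF _ fg])
    qed
  next
    fix f :: "'a \<Rightarrow> real" and c assume f: "f \<in> Cc"
    show "\<omega> (\<lambda>x. c * f x) = c * \<omega> f"
    proof (rule eq[OF lim tendsto_mult_left[OF lim]])
      show "\<forall>\<^sub>F \<mu> in G. \<mu> (\<lambda>x. c * f x) = c * \<mu> f"
        using lin by eventually_elim (rule linear_rm_cmult[OF _ f])
    qed
  next
    fix f :: "'a \<Rightarrow> real" assume f: "\<forall>x. 0 \<le> f x"
    have "\<forall>\<^sub>F \<mu> in G. 0 \<le> \<mu> f" using evG by eventually_elim (use f in \<open>auto intro: poslin_rm_nonneg\<close>)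
    then show "0 \<le> \<omega> f" by (rule tendsto_lowerbound[OF lim _ G(1)])
  qed
  then show ?thesis using that G lim by blast
qed

lemma vague_cluster_of_finer:
  assumes "real_radon \<omega>" "G \<noteq> bot" "G \<le> \<Phi>" "\<forall>f. ((\<lambda>\<mu>. \<mu> f) \<longlongrightarrow> \<omega> f) G"
  shows "vague_cluster id \<omega> \<Phi>"
  unfolding vague_cluster_def
proof (intro conjI allI impI assms(1))
  fix fs :: "('a \<Rightarrow> real) set" and e :: real assume fs: "finite fs \<and> fs \<subseteq> Cc \<and> 0 < e"
  have "\<forall>\<^sub>F \<mu> in G. \<forall>f\<in>fs. \<bar>\<mu> f - \<omega> f\<bar> < e"
    using fs assms(4) by (intro eventually_ball_finite) (auto simp: tendsto_iff dist_real_def)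
  then have "\<exists>\<^sub>F \<mu> in G. \<forall>f\<in>fs. \<bar>\<mu> f - \<omega> f\<bar> < e"
    using assms(2) by (rule eventually_frequently[rotated])
  then show "\<exists>\<^sub>F \<mu> in \<Phi>. \<forall>f\<in>fs. \<bar>id \<mu> f - \<omega> f\<bar> < e"
    using assms(3) filter_leD unfolding frequently_def by fastforce
qed

text \<open>The measure \<mu> multiplied by \<open>u\<close>. The case distinction matters: for
  \<open>u\<close> of compact support, the product \<open>u g\<close> may lie in \<open>Cc\<close>
  although \<open>g\<close> does not.\<close>

definition density :: "('a::topological_space \<Rightarrow> real) \<Rightarrow> 'a rmeas \<Rightarrow> 'a rmeas" where
  "density u \<mu> = (\<lambda>g. if g \<in> Cc then \<mu> (\<lambda>x. u x * g x) else 0)"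

lemma poslin_density:
  assumes \<mu>: "poslin_rm \<mu>" and u: "continuous_on UNIV u" "\<And>x. 0 \<le> u x"
  shows "poslin_rm (density u \<mu>)"
  unfolding poslin_rm_def linear_rm_def positive_rm_def
proof (intro conjI allI ballI impI)
  note l = poslin_rmD[OF \<mu>]
  fix f g :: "'a \<Rightarrow> real" and c :: real assume f: "f \<in> Cc"
  have "(\<lambda>x. u x * (c * f x)) = (\<lambda>x. c * (u x * f x))" by (simp add: mult.left_commute)
  then show "density u \<mu> (\<lambda>x. c * f x) = c * density u \<mu> f"
    using linear_rm_cmult[OF l Cc_mult_continuous[OF u(1) f]] f by (simp add: density_def)
  {
    assume g: "g \<in> Cc"
    show "density u \<mu> (\<lambda>x. f x + g x) = density u \<mu> f + density u \<mu> g"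
      using linear_rm_add[OF l Cc_mult_continuous[OF u(1) f] Cc_mult_continuous[OF u(1) g]] f g
      by (simp add: density_def distrib_left)
  }
  assume "\<forall>x. 0 \<le> f x"
  then show "0 \<le> density u \<mu> f"
    using u(2) by (auto simp: density_def intro!: poslin_rm_nonneg[OF \<mu>])
qed (simp add: density_def)

lemma density_split:
  assumes \<mu>: "linear_rm \<mu>" and u: "continuous_on UNIV u"
  shows "density u \<mu> + density (\<lambda>x. 1 - u x) \<mu> = \<mu>"
proof
  fix f
  show "(density u \<mu> + density (\<lambda>x. 1 - u x) \<mu>) f = \<mu> f"
  proof (cases "f \<in> Cc")
    case True
    have "\<mu> (\<lambda>x. u x * f x + (1 - u x) * f x) = \<mu> (\<lambda>x. u x * f x) + \<mu> (\<lambda>x. (1 - u x) * f x)"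
      using True u by (intro linear_rm_add[OF \<mu>] Cc_mult_continuous continuous_intros)
    then show ?thesis using True by (simp add: density_def algebra_simps)
  qed (use linear_rm_outside[OF \<mu>] in \<open>auto simp: density_def\<close>)
qed

lemma conc_on_density:
  assumes "conc_on \<mu> F" "continuous_on UNIV u"
  shows "conc_on (density u \<mu>) (tsupp u \<inter> F)"
  unfolding conc_on_def
proof (intro ballI impI)
  fix f :: "'a \<Rightarrow> real" assume f: "f \<in> Cc" "tsupp f \<inter> (tsupp u \<inter> F) = {}"
  have "tsupp (\<lambda>x. u x * f x) \<subseteq> tsupp f \<inter> tsupp u"
    by (rule tsupp_minimal) (auto simp: eq_0_outside_tsupp)
  then have "tsupp (\<lambda>x. u x * f x) \<inter> F = {}" using f(2) by blast
  then show "density u \<mu> f = 0"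
    using assms Cc_mult_continuous[OF assms(2) f(1)] f(1) by (auto simp: conc_on_def density_def)
qed

text \<open>With \<open>u = 1\<close> on both projections of the support of \<open>g\<close>,
  multiplying \<open>g\<close> by \<open>u\<close> in either variable leaves it unchanged.\<close>

lemma tensor_density:
  fixes \<mu> :: "'a::t2_space rmeas"
  assumes g: "g \<in> Cc" and \<mu>: "real_radon \<mu>"
    and u: "\<forall>x \<in> fst ` tsupp g \<union> snd ` tsupp g. u x = 1"
  shows "tensor (density u \<mu>) (density u \<mu>) g = tensor \<mu> \<mu> g"
proof -
  have "u y * g (x, y) = g (x, y)" for x y
    using u section_eq_0(2)[of y g x] by (cases "y \<in> snd ` tsupp g") auto
  then have "(\<lambda>y. u y * g (x, y)) = (\<lambda>y. g (x, y))" for x by (rule ext)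
  then have inner: "density u \<mu> (\<lambda>y. g (x, y)) = \<mu> (\<lambda>y. g (x, y))" for x
    using Cc_section[OF g] unfolding density_def by (metis (no_types))
  have "u x * \<mu> (\<lambda>y. g (x, y)) = \<mu> (\<lambda>y. g (x, y))" for x
  proof (cases "x \<in> fst ` tsupp g")
    case False
    then have "(\<lambda>y. g (x, y)) = (\<lambda>y. 0)" using section_eq_0(1) by blast
    then show ?thesis using linear_rm_zero[OF real_radon_linear[OF \<mu>]] by simp
  qed (use u in auto)
  then have "(\<lambda>x. u x * \<mu> (\<lambda>y. g (x, y))) = (\<lambda>x. \<mu> (\<lambda>y. g (x, y)))" by (rule ext)
  then have "density u \<mu> (\<lambda>x. \<mu> (\<lambda>y. g (x, y))) = \<mu> (\<lambda>x. \<mu> (\<lambda>y. g (x, y)))"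
    using Cc_partial_integral[OF g \<mu>] unfolding density_def by metis
  then show ?thesis using g inner by (simp add: tensor_def)
qed

section \<open>Consequences of consistency: strong bounds control vague ones\<close>

context perfect_lc_kernel
begin

lemma minus_zero_rm [simp]: "x - (\<lambda>f. 0) = (x :: 'a rmeas)"
  by (simp add: fun_diff_def)

lemma zero_Emeas: "(\<lambda>f. 0) \<in> Emeas \<kappa>"
  using zero_Ep Ep_subset_Emeas by blast

lemma Ep_Emeas: "a \<in> Ep \<Longrightarrow> a \<in> Emeas \<kappa>"
  using Ep_subset_Emeas by blast

lemma enorm_minus_commute:
  assumes "x \<in> Emeas \<kappa>" "y \<in> Emeas \<kappa>"
  shows "enorm \<kappa> (x - y) = enorm \<kappa> (y - x)"
proof -
  obtain a b where ab: "a \<in> Ep" "b \<in> Ep" "x - y = a - b" by (rule Emeas_decomp[OF Emeas_diff[OF assms]])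
  have "y - x = b - a" using ab(3) by (metis minus_diff_eq)
  then show ?thesis using ab Q_minus[OF ab(1,2)] Q_minus[OF ab(2,1)] by (simp add: enorm_eq)
qed

lemma enorm_triangle3:
  assumes "x \<in> Emeas \<kappa>" "y \<in> Emeas \<kappa>" "z \<in> Emeas \<kappa>"
  shows "enorm \<kappa> (x - z) \<le> enorm \<kappa> (x - y) + enorm \<kappa> (y - z)"
  using enorm_triangle[OF Emeas_diff[OF assms(1,2)] Emeas_diff[OF assms(2,3)]] by simp

lemma enorm_diff_le:
  assumes "x \<in> Emeas \<kappa>" "y \<in> Emeas \<kappa>"
  shows "enorm \<kappa> (x - y) \<le> enorm \<kappa> x + enorm \<kappa> y"
  using enorm_triangle3[OF assms(1) zero_Emeas assms(2)] enorm_minus_commute[OF zero_Emeas assms(2)] by simp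

lemma enorm_eq_0:
  assumes "x \<in> Emeas \<kappa>" "y \<in> Emeas \<kappa>" "enorm \<kappa> (x - y) \<le> 0"
  shows "x = y"
proof -
  have "Q (x - y) = 0"
    using assms(3) enorm_nonneg[OF Emeas_diff[OF assms(1,2)]] by (simp add: enorm_eq)
  then have "x - y = (\<lambda>f. 0)" by (rule Q_eq_0[OF Emeas_diff[OF assms(1,2)]])
  then show ?thesis by (simp add: fun_eq_iff)
qed

lemma enorm_scale:
  assumes "x \<in> Emeas \<kappa>" "0 \<le> c"
  shows "enorm \<kappa> (\<lambda>f. c * x f) = c * enorm \<kappa> x"
  using Q_scale(2)[OF assms] assms(2) by (simp add: enorm_eq real_sqrt_mult)

text \<open>Consistency, applied to a filter that is vaguely bounded and hence has a vague cluster point.\<close>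

lemma Cauchy_converges:
  assumes \<Phi>: "\<Phi> \<noteq> bot" and ev: "\<forall>\<^sub>F \<mu> in \<Phi>. \<mu> \<in> Ep \<and> (\<forall>f\<in>Cc. \<bar>\<mu> f\<bar> \<le> C f)"
    and cau: "\<And>e. 0 < e \<Longrightarrow> \<exists>P. eventually P \<Phi> \<and> (\<forall>x y. P x \<longrightarrow> P y \<longrightarrow> enorm \<kappa> (x - y) < e)"
  obtains \<omega> G where "\<omega> \<in> Ep" "G \<noteq> bot" "G \<le> \<Phi>" "\<forall>f. ((\<lambda>\<mu>. \<mu> f) \<longlongrightarrow> \<omega> f) G"
    "((\<lambda>\<mu>. enorm \<kappa> (\<mu> - \<omega>)) \<longlongrightarrow> 0) \<Phi>"
proof -
  have "\<forall>\<^sub>F \<mu> in \<Phi>. poslin_rm \<mu> \<and> (\<forall>f\<in>Cc. \<bar>\<mu> f\<bar> \<le> C f)"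
    using ev by eventually_elim (auto dest: Ep_poslin)
  then obtain \<omega> G where \<omega>: "poslin_rm \<omega>" "G \<noteq> bot" "G \<le> \<Phi>" "\<forall>f. ((\<lambda>\<mu>. \<mu> f) \<longlongrightarrow> \<omega> f) G"
    by (rule vague_compact[OF \<Phi>])
  have cl: "vague_cluster id \<omega> \<Phi>"
    by (rule vague_cluster_of_finer[OF poslin_radon[OF \<omega>(1)] \<omega>(2-4)])
  have evp: "\<forall>\<^sub>F \<mu> in \<Phi>. \<mu> \<in> Emeas_pos \<kappa>" "\<forall>\<^sub>F \<mu> in \<Phi>. \<mu> \<in> Emeas \<kappa>"
    using ev by (eventually_elim, simp add: Emeas_pos_eq Ep_Emeas)+
  have "strong_cauchy \<kappa> id \<Phi>"
    unfolding strong_cauchy_def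
  proof (intro conjI allI impI)
    fix e :: real assume "0 < e"
    then obtain P where P: "eventually P \<Phi>" "\<forall>x y. P x \<longrightarrow> P y \<longrightarrow> enorm \<kappa> (x - y) < e"
      using cau by blast
    have "\<forall>\<^sub>F p in \<Phi> \<times>\<^sub>F \<Phi>. P (fst p) \<and> P (snd p)" by (rule eventually_prodI[OF P(1) P(1)])
    then show "\<forall>\<^sub>F (i, j) in \<Phi> \<times>\<^sub>F \<Phi>. enorm \<kappa> (id i - id j) < e"
      by eventually_elim (use P(2) in auto)
  qed (use evp in simp)
  then have st: "strong_tendsto \<kappa> id \<omega> \<Phi>"
    using perfect \<Phi> evp(1) cl unfolding perfect_kernel_def by blast
  then have "\<omega> \<in> Ep" using \<omega>(1) Emeas_pos_eq by (auto simp: strong_tendsto_def Emeas_pos_def poslin_rm_def)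
  then show ?thesis using that \<omega> st by (simp add: strong_tendsto_def)
qed

text \<open>By consistency the sequence converges strongly to a vague cluster point. That point has
  norm 0, hence is 0, but vague convergence along a finer filter preserves the value 1 at
  \<theta>.\<close>

lemma no_null_sequence:
  fixes w :: "nat \<Rightarrow> 'a rmeas"
  assumes w: "\<And>n. w n \<in> Ep" "(\<lambda>n. enorm \<kappa> (w n)) \<longlonglongrightarrow> 0" "\<And>n f. f \<in> Cc \<Longrightarrow> \<bar>w n f\<bar> \<le> C f"
    and \<theta>: "\<And>n. w n \<theta> = 1"
  shows False
proof -
  let ?\<Phi> = "filtermap w sequentially"
  have small: "\<forall>\<^sub>F \<mu> in ?\<Phi>. \<mu> \<in> Ep \<and> enorm \<kappa> \<mu> < e" if "0 < e" for e
    unfolding eventually_filtermap using order_tendstoD(2)[OF w(2) that] w(1) by simp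
  have ev: "\<forall>\<^sub>F \<mu> in ?\<Phi>. \<mu> \<in> Ep \<and> (\<forall>f\<in>Cc. \<bar>\<mu> f\<bar> \<le> C f)"
    unfolding eventually_filtermap using w by simp
  have cau: "\<exists>P. eventually P ?\<Phi> \<and> (\<forall>x y. P x \<longrightarrow> P y \<longrightarrow> enorm \<kappa> (x - y) < e)" if "0 < e" for e
  proof (intro exI conjI allI impI)
    show "\<forall>\<^sub>F \<mu> in ?\<Phi>. \<mu> \<in> Ep \<and> enorm \<kappa> \<mu> < e / 2" by (rule small) (use that in simp)
    fix x y assume "x \<in> Ep \<and> enorm \<kappa> x < e / 2" "y \<in> Ep \<and> enorm \<kappa> y < e / 2"
    then show "enorm \<kappa> (x - y) < e" using enorm_diff_le[of x y] Ep_Emeas by force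
  qed
  obtain \<omega> G where \<omega>: "\<omega> \<in> Ep" "G \<noteq> bot" "G \<le> ?\<Phi>" "\<forall>f. ((\<lambda>\<mu>. \<mu> f) \<longlongrightarrow> \<omega> f) G"
      "((\<lambda>\<mu>. enorm \<kappa> (\<mu> - \<omega>)) \<longlongrightarrow> 0) ?\<Phi>"
    by (rule Cauchy_converges[OF _ ev cau]) (simp add: filtermap_bot_iff)
  have "(\<lambda>n. enorm \<kappa> (w n - \<omega>) + enorm \<kappa> (w n)) \<longlonglongrightarrow> 0 + 0"
    using \<omega>(5) w(2) by (intro tendsto_add) (simp_all add: filterlim_filtermap)
  moreover have "enorm \<kappa> \<omega> \<le> enorm \<kappa> (w n - \<omega>) + enorm \<kappa> (w n)" for n
    using enorm_triangle3[of \<omega> "w n" "\<lambda>f. 0"] enorm_minus_commute[of \<omega> "w n"] \<omega>(1) w(1)[of n] zero_Emeas Ep_Emeas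
    by simp
  ultimately have "enorm \<kappa> \<omega> \<le> 0 + 0" by (intro LIMSEQ_le_const) auto
  then have "\<omega> = (\<lambda>f. 0)" using enorm_eq_0[OF Ep_Emeas[OF \<omega>(1)] zero_Emeas] by simp
  moreover have "\<forall>\<^sub>F \<mu> in ?\<Phi>. \<mu> \<theta> = 1" unfolding eventually_filtermap using \<theta> by simp
  then have "\<forall>\<^sub>F \<mu> in G. \<mu> \<theta> = 1" using \<omega>(3) filter_leD by blast
  then have "((\<lambda>\<mu>. \<mu> \<theta>) \<longlongrightarrow> 1) G" by (rule tendsto_eventually)
  then have "\<omega> \<theta> = 1" using \<omega>(2,4) tendsto_unique by blast
  ultimately show False by simp
qed

text \<open>\<open>T\<close> is a cut-off: the identity on a compact space, multiplication by \<phi>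
  otherwise; \<theta> recovers the mass \<open>\<mu> \<phi>\<close> from \<open>T \<mu>\<close>. If
  no \<open>C\<close> existed, dividing \<open>T \<mu>\<close> by \<open>\<mu> \<phi>\<close> would
  produce a sequence excluded by \<open>no_null_sequence\<close>.\<close>

lemma mass_bound:
  assumes \<phi>: "\<And>\<mu>. \<mu> \<in> Ep \<Longrightarrow> T \<mu> \<in> Ep" "\<And>\<mu>. \<mu> \<in> Ep \<Longrightarrow> enorm \<kappa> (T \<mu>) \<le> enorm \<kappa> \<mu>"
      "\<And>\<mu> g. \<mu> \<in> Ep \<Longrightarrow> g \<in> Cc \<Longrightarrow> \<bar>T \<mu> g\<bar> \<le> B g * \<mu> \<phi>" "\<And>\<mu>. \<mu> \<in> Ep \<Longrightarrow> T \<mu> \<theta> = \<mu> \<phi>"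
  shows "\<exists>C. \<forall>\<mu>\<in>Ep. \<mu> \<phi> \<le> C * enorm \<kappa> \<mu>"
proof (rule ccontr)
  assume "\<not> ?thesis"
  then have "\<forall>n::nat. \<exists>\<mu>. \<mu> \<in> Ep \<and> real (Suc n) * enorm \<kappa> \<mu> < \<mu> \<phi>" by (meson linorder_not_less)
  then have "\<exists>m. \<forall>n::nat. m n \<in> Ep \<and> real (Suc n) * enorm \<kappa> (m n) < m n \<phi>" by (rule choice)
  then obtain m where m: "\<forall>n::nat. m n \<in> Ep \<and> real (Suc n) * enorm \<kappa> (m n) < m n \<phi>" by (elim exE)
  have mE: "m n \<in> Ep" for n using m by simp
  have pos: "0 < m n \<phi>" for n
  proof -
    have "0 \<le> real (Suc n) * enorm \<kappa> (m n)" using enorm_nonneg[OF Ep_Emeas[OF mE]] by simp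
    then show ?thesis using m by (meson le_less_trans)
  qed
  let ?w = "\<lambda>n f. (1 / m n \<phi>) * T (m n) f"
  show False
  proof (rule no_null_sequence[of ?w B \<theta>])
    show "?w n \<in> Ep" for n using \<phi>(1)[OF mE] pos[of n] by (intro Ep_scale) auto
    have "enorm \<kappa> (?w n) \<le> inverse (real (Suc n))" for n
    proof -
      have "enorm \<kappa> (?w n) = (1 / m n \<phi>) * enorm \<kappa> (T (m n))"
        using \<phi>(1)[OF mE] pos[of n] by (intro enorm_scale Ep_Emeas) auto
      also have "\<dots> \<le> (1 / m n \<phi>) * enorm \<kappa> (m n)" using \<phi>(2)[OF mE] pos[of n] by (intro mult_left_mono) auto
      also have "\<dots> \<le> inverse (real (Suc n))"
        using m pos[of n] by (simp add: field_simps less_imp_le del: of_nat_Suc)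
      finally show ?thesis .
    qed
    moreover have "0 \<le> enorm \<kappa> (?w n)" for n
      using \<phi>(1)[OF mE] pos[of n] by (intro enorm_nonneg Ep_Emeas Ep_scale) auto
    ultimately show "(\<lambda>n. enorm \<kappa> (?w n)) \<longlonglongrightarrow> 0"
      by (intro tendsto_sandwich[OF _ _ tendsto_const LIMSEQ_inverse_real_of_nat]) auto
    show "\<bar>?w n f\<bar> \<le> B f" if "f \<in> Cc" for n f
      using \<phi>(3)[OF mE that, of n] pos[of n] by (simp add: abs_mult field_simps)
    show "?w n \<theta> = 1" for n using \<phi>(4)[OF mE, of n] pos[of n] by simp
  qed
qed

lemma J_nonneg:
  assumes "\<not> compact (UNIV :: 'a set)" "linear_rm A"
  shows "0 \<le> J A"
  using J_upper[OF zero_minorant[OF assms(1)], of A] linear_rm_zero[OF assms(2)] by (simp add: zero_ereal_def)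

lemma Ep_summands:
  assumes nc: "\<not> compact (UNIV :: 'a set)" and p: "poslin_rm p" and q: "poslin_rm q" and pq: "p + q \<in> Ep"
  shows "p \<in> Ep" "q \<in> Ep" "Q p + Q q \<le> Q (p + q)"
proof -
  note r = p[THEN poslin_radon] q[THEN poslin_radon]
  have "tensor (p + q) (p + q) = (tensor p p + tensor p q) + (tensor q p + tensor q q)"
    using r poslin_radon[OF poslin_rm_plus[OF p q]] by (simp add: tensor_plus_left tensor_plus_right)
  then have "J ((tensor p p + tensor p q) + (tensor q p + tensor q q)) \<noteq> \<infinity>"
    using pq by (simp add: Ep_def)
  then have "J (tensor p p) \<noteq> \<infinity>" "J (tensor q q) \<noteq> \<infinity>"
    using J_plus_finite[of "tensor p p + tensor p q" "tensor q p + tensor q q"]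
      J_plus_finite[of "tensor p p" "tensor p q"] J_plus_finite[of "tensor q p" "tensor q q"]
    by (auto simp: poslin_rm_plus poslin_tensor' p q)
  then show E: "p \<in> Ep" "q \<in> Ep" using p q by (auto simp: Ep_def)
  have "0 \<le> mutual p q" "0 \<le> mutual q p"
    unfolding mutual_def using nc p q
    by (auto intro!: real_of_ereal_pos J_nonneg poslin_rmD poslin_tensor')
  then show "Q p + Q q \<le> Q (p + q)"
    using E by (simp add: Q_Ep Ep_plus mutual_plus_left mutual_plus_right)
qed

lemma density_Ep:
  assumes nc: "\<not> compact (UNIV :: 'a set)" and \<mu>: "\<mu> \<in> Ep"
    and u: "continuous_on UNIV u" "\<forall>x. 0 \<le> u x \<and> u x \<le> 1"
  shows "density u \<mu> \<in> Ep" "\<mu> - density u \<mu> \<in> Ep" "Q (density u \<mu>) + Q (\<mu> - density u \<mu>) \<le> Q \<mu>"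
proof -
  note l = Ep_poslin[OF \<mu>]
  have s: "density u \<mu> + density (\<lambda>x. 1 - u x) \<mu> = \<mu>" by (rule density_split[OF poslin_rmD[OF l] u(1)])
  have d: "\<mu> - density u \<mu> = density (\<lambda>x. 1 - u x) \<mu>" by (metis s add_diff_cancel_left')
  have p: "poslin_rm (density u \<mu>)" "poslin_rm (density (\<lambda>x. 1 - u x) \<mu>)"
    using u by (auto intro!: poslin_density l continuous_intros)
  show "density u \<mu> \<in> Ep" "\<mu> - density u \<mu> \<in> Ep" "Q (density u \<mu>) + Q (\<mu> - density u \<mu>) \<le> Q \<mu>"
    using Ep_summands[OF nc p] \<mu> unfolding d s by auto
qed

text \<open>It suffices to bound the mass on one \<phi> that equals 1 on the support of
  \<open>f\<close>, since \<open>f\<close> is dominated by a multiple of \<phi>.\<close>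

lemma vague_bound:
  assumes f: "f \<in> Cc"
  shows "\<exists>C. \<forall>\<mu>\<in>Ep. \<bar>\<mu> f\<bar> \<le> C * enorm \<kappa> \<mu>"
proof -
  have "\<exists>\<phi> C. \<phi> \<in> Cc \<and> (\<forall>x. 0 \<le> \<phi> x) \<and> (\<forall>x\<in>tsupp f. \<phi> x = 1) \<and> (\<forall>\<mu>\<in>Ep. \<mu> \<phi> \<le> C * enorm \<kappa> \<mu>)"
  proof (cases "compact (UNIV :: 'a set)")
    case True
    let ?one = "\<lambda>x::'a. 1::real"
    have one: "?one \<in> Cc" by (rule CcI[OF _ True]) auto
    have "\<exists>C. \<forall>\<mu>\<in>Ep. \<mu> ?one \<le> C * enorm \<kappa> \<mu>"
    proof (rule mass_bound[where T="\<lambda>\<mu>. \<mu>" and B="\<lambda>g. SUP x. \<bar>g x\<bar>" and \<theta>="?one"])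
      fix \<mu> and g :: "'a \<Rightarrow> real" assume \<mu>: "\<mu> \<in> Ep" and g: "g \<in> Cc"
      have "\<bar>\<mu> g\<bar> \<le> \<mu> (\<lambda>x. (SUP x. \<bar>g x\<bar>) * ?one x)"
        using g abs_le_SUP_Cc[OF g] by (intro poslin_rm_abs[OF Ep_poslin[OF \<mu>]] Cc_cmult one) auto
      then show "\<bar>\<mu> g\<bar> \<le> (SUP x. \<bar>g x\<bar>) * \<mu> ?one"
        unfolding linear_rm_cmult[OF poslin_rmD[OF Ep_poslin[OF \<mu>]] one] .
    qed auto
    then show ?thesis using one by (intro exI[of _ ?one]) auto
  next
    case nc: False
    obtain \<phi> where \<phi>: "\<phi> \<in> Cc" "\<forall>x. 0 \<le> \<phi> x \<and> \<phi> x \<le> 1" "\<forall>x\<in>tsupp f. \<phi> x = 1" "\<forall>x. x \<notin> UNIV \<longrightarrow> \<phi> x = 0"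
      by (rule Cc_Urysohn[OF lc Cc_compact_tsupp[OF f] open_UNIV subset_UNIV])
    \<comment> \<open>As \<theta> is 1 on the support of \<phi>, the cut-off measure has the value
      \<open>\<mu> \<phi>\<close> at \<theta>.\<close>
    obtain \<theta> where \<theta>: "\<theta> \<in> Cc" "\<forall>x. 0 \<le> \<theta> x \<and> \<theta> x \<le> 1" "\<forall>x\<in>tsupp \<phi>. \<theta> x = 1" "\<forall>x. x \<notin> UNIV \<longrightarrow> \<theta> x = 0"
      by (rule Cc_Urysohn[OF lc Cc_compact_tsupp[OF \<phi>(1)] open_UNIV subset_UNIV])
    note c = Cc_continuous[OF \<phi>(1)]
    have "\<exists>C. \<forall>\<mu>\<in>Ep. \<mu> \<phi> \<le> C * enorm \<kappa> \<mu>"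
    proof (rule mass_bound[where T="density \<phi>" and B="\<lambda>g. SUP x. \<bar>g x\<bar>" and \<theta>=\<theta>])
      fix \<mu> assume \<mu>: "\<mu> \<in> Ep"
      note d = density_Ep[OF nc \<mu> c \<phi>(2)]
      show "density \<phi> \<mu> \<in> Ep" by (rule d(1))
      show "enorm \<kappa> (density \<phi> \<mu>) \<le> enorm \<kappa> \<mu>"
        using d(3) Q_nonneg[OF Ep_Emeas[OF d(2)]] by (simp add: enorm_eq)
      have "\<phi> x * \<theta> x = \<phi> x" for x
        using \<theta>(3) eq_0_outside_tsupp[of x \<phi>] by (cases "x \<in> tsupp \<phi>") auto
      then have "(\<lambda>x. \<phi> x * \<theta> x) = \<phi>" by (rule ext)
      then show "density \<phi> \<mu> \<theta> = \<mu> \<phi>" using \<theta>(1) unfolding density_def by metis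
      fix g :: "'a \<Rightarrow> real" assume g: "g \<in> Cc"
      have "\<bar>\<mu> (\<lambda>x. \<phi> x * g x)\<bar> \<le> \<mu> (\<lambda>x. (SUP x. \<bar>g x\<bar>) * \<phi> x)"
      proof (intro poslin_rm_abs[OF Ep_poslin[OF \<mu>]] Cc_cmult \<phi>(1) Cc_mult_continuous[OF c g])
        fix x show "\<bar>\<phi> x * g x\<bar> \<le> (SUP x. \<bar>g x\<bar>) * \<phi> x"
          using abs_le_SUP_Cc[OF g, of x] \<phi>(2) by (simp add: abs_mult mult.commute mult_left_mono)
      qed
      then show "\<bar>density \<phi> \<mu> g\<bar> \<le> (SUP x. \<bar>g x\<bar>) * \<mu> \<phi>"
        unfolding linear_rm_cmult[OF poslin_rmD[OF Ep_poslin[OF \<mu>]] \<phi>(1)] using g by (simp add: density_def)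
    qed
    then show ?thesis using \<phi> by (intro exI[of _ \<phi>]) auto
  qed
  then obtain \<phi> C where \<phi>: "\<phi> \<in> Cc" "\<forall>x. 0 \<le> \<phi> x" "\<forall>x\<in>tsupp f. \<phi> x = 1" "\<forall>\<mu>\<in>Ep. \<mu> \<phi> \<le> C * enorm \<kappa> \<mu>"
    by (elim exE conjE)
  let ?S = "SUP x. \<bar>f x\<bar>"
  have "\<bar>\<mu> f\<bar> \<le> (?S * C) * enorm \<kappa> \<mu>" if \<mu>: "\<mu> \<in> Ep" for \<mu>
  proof -
    have "\<bar>\<mu> f\<bar> \<le> \<mu> (\<lambda>x. ?S * \<phi> x)"
    proof (intro poslin_rm_abs[OF Ep_poslin[OF \<mu>]] Cc_cmult \<phi>(1) f)
      fix x show "\<bar>f x\<bar> \<le> ?S * \<phi> x"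
        using abs_le_SUP_Cc[OF f, of x] \<phi>(2,3) eq_0_outside_tsupp[of x f] SUP_abs_Cc_nonneg[OF f]
        by (cases "x \<in> tsupp f") auto
    qed
    also have "\<dots> = ?S * \<mu> \<phi>" by (rule linear_rm_cmult[OF poslin_rmD[OF Ep_poslin[OF \<mu>]] \<phi>(1)])
    also have "\<dots> \<le> ?S * (C * enorm \<kappa> \<mu>)"
      using \<phi>(4) \<mu> SUP_abs_Cc_nonneg[OF f] by (intro mult_left_mono) auto
    finally show ?thesis by (simp add: mult.assoc)
  qed
  then show ?thesis by blast
qed

lemma vague_bound_uniform:
  obtains C where "\<forall>\<mu>\<in>Ep. enorm \<kappa> \<mu> \<le> R \<longrightarrow> (\<forall>f\<in>Cc. \<bar>\<mu> f\<bar> \<le> C f)"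
proof -
  have "\<forall>f. \<exists>C. f \<in> Cc \<longrightarrow> (\<forall>\<mu>\<in>Ep. \<bar>\<mu> f\<bar> \<le> C * enorm \<kappa> \<mu>)" using vague_bound by blast
  then have "\<exists>C. \<forall>f. f \<in> Cc \<longrightarrow> (\<forall>\<mu>\<in>Ep. \<bar>\<mu> f\<bar> \<le> C f * enorm \<kappa> \<mu>)" by (rule choice)
  then obtain C where C: "\<forall>f. f \<in> Cc \<longrightarrow> (\<forall>\<mu>\<in>Ep. \<bar>\<mu> f\<bar> \<le> C f * enorm \<kappa> \<mu>)" by (elim exE)
  show ?thesis
  proof (rule that[of "\<lambda>f. \<bar>C f\<bar> * R"], intro ballI impI)
    fix \<mu> and f :: "'a \<Rightarrow> real" assume a: "\<mu> \<in> Ep" "enorm \<kappa> \<mu> \<le> R" "f \<in> Cc"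
    have "\<bar>\<mu> f\<bar> \<le> C f * enorm \<kappa> \<mu>" using C a by blast
    also have "\<dots> \<le> \<bar>C f\<bar> * R" using a enorm_nonneg[OF Ep_Emeas[OF a(1)]] by (intro mult_mono) auto
    finally show "\<bar>\<mu> f\<bar> \<le> \<bar>C f\<bar> * R" .
  qed
qed

text \<open>A minorant \<open>g\<close> nearly attaining the energy of \<mu> sees only the
  projections of its support. If \<phi> is 1 there, the cut-off measure has energy above
  \<open>Q \<mu>\<close> minus the square of \<open>e\<close>, and superadditivity leaves less than
  that square for the remainder.\<close>

lemma density_approximation:
  assumes nc: "\<not> compact (UNIV :: 'a set)" and \<mu>: "\<mu> \<in> Ep" and e: "0 < e"
  obtains \<phi> where "\<phi> \<in> Cc" "\<forall>x. 0 \<le> \<phi> x \<and> \<phi> x \<le> 1" "enorm \<kappa> (\<mu> - density \<phi> \<mu>) < e"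
proof -
  have eq: "ereal (Q \<mu>) = J (tensor \<mu> \<mu>)"
    unfolding Q_Ep[OF \<mu>] mutual_def by (rule ereal_real_J[OF Ep_mutual_finite[OF \<mu> \<mu>]])
  have "ereal (Q \<mu> - e\<^sup>2) < J (tensor \<mu> \<mu>)" using e by (simp flip: eq)
  then obtain g where g: "g \<in> minorants" "Q \<mu> - e\<^sup>2 < tensor \<mu> \<mu> g"
    unfolding J_def less_SUP_iff by auto
  note gC = minorants_Cc[OF g(1)]
  let ?K = "fst ` tsupp g \<union> snd ` tsupp g"
  have K: "compact ?K" using compact_fst_tsupp[OF gC] compact_snd_tsupp[OF gC] by auto
  obtain \<phi> where \<phi>: "\<phi> \<in> Cc" "\<forall>x. 0 \<le> \<phi> x \<and> \<phi> x \<le> 1" "\<forall>x\<in>?K. \<phi> x = 1" "\<forall>x. x \<notin> UNIV \<longrightarrow> \<phi> x = 0"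
    by (rule Cc_Urysohn[OF lc K open_UNIV subset_UNIV])
  note d = density_Ep[OF nc \<mu> Cc_continuous[OF \<phi>(1)] \<phi>(2)]
  have "ereal (tensor \<mu> \<mu> g) \<le> J (tensor (density \<phi> \<mu>) (density \<phi> \<mu>))"
    using J_upper[OF g(1), of "tensor (density \<phi> \<mu>) (density \<phi> \<mu>)"]
      tensor_density[OF gC poslin_radon[OF Ep_poslin[OF \<mu>]] \<phi>(3)] by simp
  also have "\<dots> = ereal (Q (density \<phi> \<mu>))"
    unfolding Q_Ep[OF d(1)] mutual_def by (rule ereal_real_J[OF Ep_mutual_finite[OF d(1) d(1)], symmetric])
  finally have "Q (\<mu> - density \<phi> \<mu>) < e\<^sup>2" using g(2) d(3) by simp
  then have "enorm \<kappa> (\<mu> - density \<phi> \<mu>) < e"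
    unfolding enorm_eq using e by (simp add: real_less_lsqrt)
  then show ?thesis using that \<phi> by blast
qed

text \<open>Otherwise the filter can be restricted to measures that stay \<open>e\<close> away from
  \<omega> at \<open>f\<close>. It is still Cauchy and vaguely bounded, so it has a vague cluster
  point that is also its strong limit. Strong limits being unique, this point is \<omega>, which
  contradicts the distance at \<open>f\<close>.\<close>

lemma strong_imp_vague:
  assumes ev: "\<forall>\<^sub>F \<mu> in \<Phi>. \<mu> \<in> Ep" and \<omega>: "\<omega> \<in> Ep" and lim: "((\<lambda>\<mu>. enorm \<kappa> (\<mu> - \<omega>)) \<longlongrightarrow> 0) \<Phi>"
  shows "((\<lambda>\<mu>. \<mu> f) \<longlongrightarrow> \<omega> f) \<Phi>"
proof (rule ccontr)
  assume "\<not> ?thesis"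
  then obtain e where e: "0 < e" "\<not> (\<forall>\<^sub>F \<mu> in \<Phi>. dist (\<mu> f) (\<omega> f) < e)" unfolding tendsto_iff by blast
  define \<Psi> where "\<Psi> = inf \<Phi> (principal {\<mu>. e \<le> dist (\<mu> f) (\<omega> f)})"
  have \<Psi>: "\<Psi> \<noteq> bot" "\<Psi> \<le> \<Phi>"
    using e(2) by (auto simp: \<Psi>_def trivial_limit_def eventually_inf_principal not_le)
  have far: "\<forall>\<^sub>F \<mu> in \<Psi>. e \<le> dist (\<mu> f) (\<omega> f)"
    by (simp add: \<Psi>_def eventually_inf_principal)
  have ev': "\<forall>\<^sub>F \<mu> in \<Psi>. \<mu> \<in> Ep" using ev \<Psi>(2) filter_leD by blast
  have lim': "((\<lambda>\<mu>. enorm \<kappa> (\<mu> - \<omega>)) \<longlongrightarrow> 0) \<Psi>" using lim \<Psi>(2) tendsto_mono by blast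
  have near: "\<forall>\<^sub>F \<mu> in \<Psi>. \<mu> \<in> Ep \<and> enorm \<kappa> (\<mu> - \<omega>) < d" if "0 < d" for d
    using ev' order_tendstoD(2)[OF lim' that] by eventually_elim simp
  obtain C where C: "\<forall>\<mu>\<in>Ep. enorm \<kappa> \<mu> \<le> enorm \<kappa> \<omega> + 1 \<longrightarrow> (\<forall>f\<in>Cc. \<bar>\<mu> f\<bar> \<le> C f)"
    by (rule vague_bound_uniform)
  have bd: "\<forall>\<^sub>F \<mu> in \<Psi>. \<mu> \<in> Ep \<and> (\<forall>f\<in>Cc. \<bar>\<mu> f\<bar> \<le> C f)"
    using near[OF zero_less_one]
  proof eventually_elim
    case (elim \<mu>)
    then have "enorm \<kappa> \<mu> \<le> enorm \<kappa> \<omega> + 1"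
      using enorm_triangle3[of \<mu> \<omega> "\<lambda>f. 0"] \<omega> Ep_Emeas zero_Emeas by simp
    then show ?case using C elim by blast
  qed
  have cau: "\<exists>P. eventually P \<Psi> \<and> (\<forall>x y. P x \<longrightarrow> P y \<longrightarrow> enorm \<kappa> (x - y) < d)" if "0 < d" for d
  proof (intro exI conjI allI impI)
    show "\<forall>\<^sub>F \<mu> in \<Psi>. \<mu> \<in> Ep \<and> enorm \<kappa> (\<mu> - \<omega>) < d / 2" by (rule near) (use that in simp)
    fix x y assume "x \<in> Ep \<and> enorm \<kappa> (x - \<omega>) < d / 2" "y \<in> Ep \<and> enorm \<kappa> (y - \<omega>) < d / 2"
    then show "enorm \<kappa> (x - y) < d"
      using enorm_triangle3[of x \<omega> y] enorm_minus_commute[of \<omega> y] \<omega> Ep_Emeas by force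
  qed
  obtain \<omega>' G where \<omega>': "\<omega>' \<in> Ep" "G \<noteq> bot" "G \<le> \<Psi>" "\<forall>f. ((\<lambda>\<mu>. \<mu> f) \<longlongrightarrow> \<omega>' f) G"
      "((\<lambda>\<mu>. enorm \<kappa> (\<mu> - \<omega>')) \<longlongrightarrow> 0) \<Psi>"
    by (rule Cauchy_converges[OF \<Psi>(1) bd cau])
  have "\<forall>\<^sub>F \<mu> in \<Psi>. enorm \<kappa> (\<omega>' - \<omega>) \<le> enorm \<kappa> (\<mu> - \<omega>') + enorm \<kappa> (\<mu> - \<omega>)"
    using ev'
  proof eventually_elim
    case (elim \<mu>)
    then show ?case
      using enorm_triangle3[of \<omega>' \<mu> \<omega>] enorm_minus_commute[of \<omega>' \<mu>] \<omega> \<omega>'(1) Ep_Emeas by simp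
  qed
  then have "enorm \<kappa> (\<omega>' - \<omega>) \<le> 0 + 0"
    by (rule tendsto_lowerbound[OF tendsto_add[OF \<omega>'(5) lim'] _ \<Psi>(1)])
  then have "\<omega>' = \<omega>" using enorm_eq_0 \<omega> \<omega>'(1) Ep_Emeas by simp
  then have "((\<lambda>\<mu>. dist (\<mu> f) (\<omega> f)) \<longlongrightarrow> dist (\<omega> f) (\<omega> f)) G"
    using \<omega>'(4) by (intro tendsto_dist tendsto_const) auto
  moreover have "\<forall>\<^sub>F \<mu> in G. e \<le> dist (\<mu> f) (\<omega> f)" using far \<omega>'(3) filter_leD by blast
  ultimately have "e \<le> dist (\<omega> f) (\<omega> f)" using \<omega>'(2) by (rule tendsto_lowerbound)
  then show False using e(1) by simp
qed

section \<open>Projection onto the cone of measures concentrated on a set\<close>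

lemma Emeas_pos_on_eq: "Emeas_pos_on \<kappa> F = {\<mu>\<in>Ep. conc_on \<mu> F}"
  by (simp add: Emeas_pos_on_def Emeas_pos_eq)

lemma Emeas_pos_on_mono: "K \<subseteq> F \<Longrightarrow> Emeas_pos_on \<kappa> K \<subseteq> Emeas_pos_on \<kappa> F"
  by (auto simp: Emeas_pos_on_def conc_on_def)

lemma Emeas_pos_on_Emeas: "\<mu> \<in> Emeas_pos_on \<kappa> F \<Longrightarrow> \<mu> \<in> Emeas \<kappa>"
  by (simp add: Emeas_pos_on_def Emeas_pos_def)

text \<open>The midpoint of \<open>a\<close> and \<open>b\<close> stays in the cone, so its squared
  distance to \<nu> is at least \<open>d\<close>; the sum in the parallelogram law is twice the
  vector from the midpoint to \<nu>, whence the factor 4. Existence, uniqueness and convergence of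
  projections all rest on this estimate.\<close>

lemma cone_parallelogram:
  assumes \<nu>: "\<nu> \<in> Emeas \<kappa>" and a: "a \<in> Emeas_pos_on \<kappa> F" and b: "b \<in> Emeas_pos_on \<kappa> F"
    and d: "\<And>m. m \<in> Emeas_pos_on \<kappa> F \<Longrightarrow> d \<le> Q (\<nu> - m)"
  shows "Q (a - b) \<le> 2 * Q (\<nu> - a) + 2 * Q (\<nu> - b) - 4 * d"
proof -
  let ?m = "\<lambda>f. (1/2) * (a + b) f"
  have m: "?m \<in> Emeas_pos_on \<kappa> F"
    using a b Ep_scale[OF Ep_plus, of a b "1/2"] by (simp add: Emeas_pos_on_eq conc_on_def)
  note e = Emeas_pos_on_Emeas[OF a] Emeas_pos_on_Emeas[OF b] Emeas_pos_on_Emeas[OF m]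
  have "(\<nu> - a) + (\<nu> - b) = (\<lambda>f. 2 * (\<nu> - ?m) f)" by (simp add: fun_eq_iff field_simps)
  then have "Q ((\<nu> - a) + (\<nu> - b)) = 4 * Q (\<nu> - ?m)"
    using Q_scale(2)[OF Emeas_diff[OF \<nu> e(3)], of 2] by simp
  moreover have "(\<nu> - a) - (\<nu> - b) = b - a" by simp
  moreover have "Q (b - a) = Q (a - b)" using enorm_minus_commute[OF e(1,2)] by (simp add: enorm_eq)
  ultimately show ?thesis
    using parallelogram[OF Emeas_diff[OF \<nu> e(1)] Emeas_diff[OF \<nu> e(2)]] d[OF m] by simp
qed

lemma proj_exists:
  assumes \<nu>: "\<nu> \<in> Emeas \<kappa>"
  shows "\<exists>\<omega>\<in>Emeas_pos_on \<kappa> F. \<forall>m\<in>Emeas_pos_on \<kappa> F. Q (\<nu> - \<omega>) \<le> Q (\<nu> - m)"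
proof -
  let ?E = "Emeas_pos_on \<kappa> F"
  have Ed: "\<nu> - m \<in> Emeas \<kappa>" if "m \<in> ?E" for m using Emeas_diff[OF \<nu> Emeas_pos_on_Emeas[OF that]] .
  have ne: "(\<lambda>f. 0) \<in> ?E" using zero_Ep by (simp add: Emeas_pos_on_eq conc_on_def)
  define d where "d = (INF m\<in>?E. Q (\<nu> - m))"
  have bdd: "bdd_below ((\<lambda>m. Q (\<nu> - m)) ` ?E)" using Q_nonneg[OF Ed] by (intro bdd_belowI2)
  have d: "d \<le> Q (\<nu> - m)" if "m \<in> ?E" for m unfolding d_def by (rule cINF_lower[OF bdd that])
  have d0: "0 \<le> d" unfolding d_def using ne Q_nonneg[OF Ed] by (intro cINF_greatest) auto
  have "\<exists>m. m \<in> ?E \<and> Q (\<nu> - m) < d + inverse (real (Suc n))" for n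
  proof -
    have "(INF m\<in>?E. Q (\<nu> - m)) < d + inverse (real (Suc n))" by (simp add: d_def)
    then show ?thesis using cINF_less_iff[OF _ bdd] ne by blast
  qed
  then have "\<exists>m. \<forall>n. m n \<in> ?E \<and> Q (\<nu> - m n) < d + inverse (real (Suc n))" by (intro choice allI)
  then obtain m where m: "\<forall>n. m n \<in> ?E \<and> Q (\<nu> - m n) < d + inverse (real (Suc n))" by (elim exE)
  let ?\<Phi> = "filtermap m sequentially"
  have Qlim: "(\<lambda>n. Q (\<nu> - m n)) \<longlonglongrightarrow> d"
  proof (rule tendsto_sandwich[where f="\<lambda>n. d" and h="\<lambda>n. d + inverse (real (Suc n))"])
    show "(\<lambda>n. d + inverse (real (Suc n))) \<longlonglongrightarrow> d"
      using tendsto_add[OF tendsto_const LIMSEQ_inverse_real_of_nat, of d] by simp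
    show "\<forall>\<^sub>F n in sequentially. d \<le> Q (\<nu> - m n)" using d m by simp
    show "\<forall>\<^sub>F n in sequentially. Q (\<nu> - m n) \<le> d + inverse (real (Suc n))"
      using m by (intro always_eventually allI less_imp_le) blast
  qed simp
  have near: "\<forall>\<^sub>F x in ?\<Phi>. x \<in> ?E \<and> Q (\<nu> - x) < d + e" if "0 < e" for e
    unfolding eventually_filtermap using order_tendstoD(2)[OF Qlim, of "d + e"] that m by simp
  \<comment> \<open>The radius comes from writing \<open>x\<close> as
    \<open>\<nu> - (\<nu> - x)\<close>, where eventually
    \<open>Q (\<nu> - x) < d + 1\<close>.\<close>
  obtain C where C: "\<forall>\<mu>\<in>Ep. enorm \<kappa> \<mu> \<le> enorm \<kappa> \<nu> + sqrt (d + 1) \<longrightarrow> (\<forall>f\<in>Cc. \<bar>\<mu> f\<bar> \<le> C f)"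
    by (rule vague_bound_uniform)
  have bd: "\<forall>\<^sub>F x in ?\<Phi>. x \<in> Ep \<and> (\<forall>f\<in>Cc. \<bar>x f\<bar> \<le> C f)"
    using near[OF zero_less_one]
  proof eventually_elim
    case (elim x)
    then have x: "x \<in> Ep" by (simp add: Emeas_pos_on_eq)
    have "\<nu> - (\<nu> - x) = x" by simp
    then have "enorm \<kappa> x \<le> enorm \<kappa> \<nu> + enorm \<kappa> (\<nu> - x)"
      using enorm_diff_le[OF \<nu> Ed[of x]] elim by simp
    also have "enorm \<kappa> (\<nu> - x) \<le> sqrt (d + 1)" using elim by (simp add: enorm_eq)
    finally show ?case using C x by simp
  qed
  \<comment> \<open>Two excesses below a quarter of the square of \<open>e\<close>, each doubled by
    \<open>cone_parallelogram\<close>, stay below that square.\<close>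
  have cau: "\<exists>P. eventually P ?\<Phi> \<and> (\<forall>x y. P x \<longrightarrow> P y \<longrightarrow> enorm \<kappa> (x - y) < e)" if e: "0 < e" for e
  proof (intro exI conjI allI impI)
    show "\<forall>\<^sub>F x in ?\<Phi>. x \<in> ?E \<and> Q (\<nu> - x) < d + e\<^sup>2 / 4" by (rule near) (use e in simp)
    fix x y assume xy: "x \<in> ?E \<and> Q (\<nu> - x) < d + e\<^sup>2 / 4" "y \<in> ?E \<and> Q (\<nu> - y) < d + e\<^sup>2 / 4"
    then have "Q (x - y) \<le> 2 * Q (\<nu> - x) + 2 * Q (\<nu> - y) - 4 * d"
      by (intro cone_parallelogram[OF \<nu> _ _ d]) auto
    then have "Q (x - y) < e\<^sup>2" using xy by simp
    then show "enorm \<kappa> (x - y) < e" unfolding enorm_eq using e by (simp add: real_less_lsqrt)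
  qed
  obtain \<omega> G where \<omega>: "\<omega> \<in> Ep" "G \<noteq> bot" "G \<le> ?\<Phi>" "\<forall>f. ((\<lambda>\<mu>. \<mu> f) \<longlongrightarrow> \<omega> f) G"
      "((\<lambda>\<mu>. enorm \<kappa> (\<mu> - \<omega>)) \<longlongrightarrow> 0) ?\<Phi>"
    by (rule Cauchy_converges[OF _ bd cau]) (simp add: filtermap_bot_iff)
  \<comment> \<open>Concentration is a condition on values at test functions supported off
    \<open>F\<close>, so it survives vague limits.\<close>
  have "conc_on \<omega> F"
    unfolding conc_on_def
  proof (intro ballI impI)
    fix f :: "'a \<Rightarrow> real" assume f: "f \<in> Cc" "tsupp f \<inter> F = {}"
    have "\<forall>\<^sub>F x in ?\<Phi>. x f = 0"
      unfolding eventually_filtermap using m f by (simp add: Emeas_pos_on_eq conc_on_def)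
    then have "\<forall>\<^sub>F x in G. x f = 0" using \<omega>(3) filter_leD by blast
    then have "((\<lambda>x. x f) \<longlongrightarrow> 0) G" by (rule tendsto_eventually)
    then show "\<omega> f = 0" using \<omega>(2,4) tendsto_unique by blast
  qed
  then have \<omega>E: "\<omega> \<in> ?E" using \<omega>(1) by (simp add: Emeas_pos_on_eq)
  have "(\<lambda>n. enorm \<kappa> (\<nu> - m n) + enorm \<kappa> (m n - \<omega>)) \<longlonglongrightarrow> sqrt d + 0"
    using \<omega>(5) tendsto_real_sqrt[OF Qlim] by (intro tendsto_add) (simp_all add: filterlim_filtermap enorm_eq)
  moreover have "enorm \<kappa> (\<nu> - \<omega>) \<le> enorm \<kappa> (\<nu> - m n) + enorm \<kappa> (m n - \<omega>)" for n
    using enorm_triangle3[OF \<nu>, of "m n" \<omega>] m \<omega>E Emeas_pos_on_Emeas by blast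
  ultimately have "enorm \<kappa> (\<nu> - \<omega>) \<le> sqrt d + 0" by (intro LIMSEQ_le_const) auto
  then have "Q (\<nu> - \<omega>) \<le> d" by (simp add: enorm_eq)
  then show ?thesis using \<omega>E d by (meson order_trans)
qed

text \<open>\<open>proj\<close> is a definite description, so uniqueness is part of the claim:
  taking \<open>d\<close> to be the minimal value in \<open>cone_parallelogram\<close>, two
  minimisers have distance 0.\<close>

lemma proj:
  assumes \<nu>: "\<nu> \<in> Emeas \<kappa>"
  shows "proj \<kappa> F \<nu> \<in> Emeas_pos_on \<kappa> F"
    and "m \<in> Emeas_pos_on \<kappa> F \<Longrightarrow> Q (\<nu> - proj \<kappa> F \<nu>) \<le> Q (\<nu> - m)"
proof -
  let ?E = "Emeas_pos_on \<kappa> F"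
  obtain \<omega> where \<omega>: "\<omega> \<in> ?E" "\<forall>m\<in>?E. Q (\<nu> - \<omega>) \<le> Q (\<nu> - m)" using proj_exists[OF \<nu>] by blast
  have "proj \<kappa> F \<nu> = \<omega>"
    unfolding proj_def enorm_eq real_sqrt_le_iff
  proof (rule the_equality)
    show "\<omega> \<in> ?E \<and> (\<forall>m\<in>?E. Q (\<nu> - \<omega>) \<le> Q (\<nu> - m))" using \<omega> by blast
    fix x assume x: "x \<in> ?E \<and> (\<forall>m\<in>?E. Q (\<nu> - x) \<le> Q (\<nu> - m))"
    have "Q (x - \<omega>) \<le> 2 * Q (\<nu> - x) + 2 * Q (\<nu> - \<omega>) - 4 * Q (\<nu> - \<omega>)"
      using x \<omega> by (intro cone_parallelogram[OF \<nu>]) auto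
    moreover have "Q (\<nu> - x) \<le> Q (\<nu> - \<omega>)" using x \<omega> by blast
    ultimately have "enorm \<kappa> (x - \<omega>) \<le> 0" by (simp add: enorm_eq)
    then show "x = \<omega>" using enorm_eq_0 x \<omega> Emeas_pos_on_Emeas by blast
  qed
  then show "proj \<kappa> F \<nu> \<in> ?E" "m \<in> ?E \<Longrightarrow> Q (\<nu> - proj \<kappa> F \<nu>) \<le> Q (\<nu> - m)" using \<omega> by auto
qed

section \<open>Positive capacity and compact subsets\<close>

lemma capacity_pos_iff:
  "0 < capacity \<kappa> K \<longleftrightarrow> (\<exists>\<mu>\<in>Emeas_pos_on \<kappa> K. total_mass \<mu> = 1)"
proof -
  let ?S = "{\<mu>\<in>Emeas_pos_on \<kappa> K. total_mass \<mu> = 1}"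
  let ?I = "INF \<mu>\<in>?S. energy \<kappa> \<mu> \<mu>"
  have "0 \<le> energy \<kappa> \<mu> \<mu>" if "\<mu> \<in> ?S" for \<mu>
    using that perfect Emeas_pos_on_Emeas[of \<mu> K] by (simp add: perfect_kernel_def Emeas_def)
  then have I0: "0 \<le> ?I" by (rule INF_greatest)
  have inv: "0 < inverse s \<longleftrightarrow> s \<noteq> \<infinity>" if "0 \<le> s" for s :: ereal
    using that by (cases s) auto
  \<comment> \<open>The infimum over the empty set is \<infinity>, with inverse 0, whereas any
    competitor has finite energy.\<close>
  have "?I \<noteq> \<infinity> \<longleftrightarrow> ?S \<noteq> {}"
  proof
    assume "?S \<noteq> {}"
    then obtain \<mu> where \<mu>: "\<mu> \<in> ?S" by blast
    then have "?I \<le> energy \<kappa> \<mu> \<mu>" by (rule INF_lower)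
    moreover have "energy \<kappa> \<mu> \<mu> \<noteq> \<infinity>" using \<mu> Emeas_pos_on_Emeas[of \<mu> K] by (auto simp: Emeas_def)
    ultimately show "?I \<noteq> \<infinity>" by auto
  next
    assume "?I \<noteq> \<infinity>"
    then show "?S \<noteq> {}" by (metis INF_empty top_ereal_def)
  qed
  then show ?thesis unfolding capacity_def inv[OF I0] by blast
qed

text \<open>In the compact case \<open>F\<close> itself is a compact subset of \<open>F\<close>; otherwise the kernel is nonnegative and
\<open>\<mu>\<close> may be multiplied by functions of compact support.\<close>

lemma capacity_pos_compact_subset:
  assumes "closed F" "0 < capacity \<kappa> F"
  shows "cpt_pos_subsets \<kappa> F \<noteq> {}"
proof (cases "compact (UNIV :: 'a set)")
  case True
  then have "compact F" using assms(1) compact_Int_closed by force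
  then have "F \<in> cpt_pos_subsets \<kappa> F" using assms(2) by (simp add: cpt_pos_subsets_def)
  then show ?thesis by blast
next
  case nc: False
  obtain \<mu> where \<mu>: "\<mu> \<in> Ep" "conc_on \<mu> F" "total_mass \<mu> = 1"
    using assms(2) capacity_pos_iff by (auto simp: Emeas_pos_on_eq)
  have "0 < total_mass \<mu>" using \<mu>(3) by simp
  then obtain \<phi> where \<phi>: "\<phi> \<in> Cc" "\<forall>x. 0 \<le> \<phi> x \<and> \<phi> x \<le> 1" "0 < \<mu> \<phi>"
    unfolding total_mass_def less_SUP_iff by auto
  \<comment> \<open>This function witnesses that the normalised measure \<open>w\<close> below has
    total mass at least 1.\<close>
  obtain \<theta> where \<theta>: "\<theta> \<in> Cc" "\<forall>x. 0 \<le> \<theta> x \<and> \<theta> x \<le> 1" "\<forall>x\<in>tsupp \<phi>. \<theta> x = 1" "\<forall>x. x \<notin> UNIV \<longrightarrow> \<theta> x = 0"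
    by (rule Cc_Urysohn[OF lc Cc_compact_tsupp[OF \<phi>(1)] open_UNIV subset_UNIV])
  note c = Cc_continuous[OF \<phi>(1)]
  define w where "w = (\<lambda>f. (1 / \<mu> \<phi>) * density \<phi> \<mu> f)"
  let ?K = "tsupp \<phi> \<inter> F"
  have "w \<in> Ep" unfolding w_def using \<phi>(3) by (intro Ep_scale density_Ep(1)[OF nc \<mu>(1) c \<phi>(2)]) simp
  moreover have "conc_on w ?K" using conc_on_density[OF \<mu>(2) c] by (simp add: w_def conc_on_def)
  moreover have "total_mass w = 1"
  proof (rule antisym)
    show "total_mass w \<le> 1"
      unfolding total_mass_def
    proof (rule SUP_least)
      fix f :: "'a \<Rightarrow> real" assume f: "f \<in> {f \<in> Cc. \<forall>x. 0 \<le> f x \<and> f x \<le> 1}"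
      have "\<mu> (\<lambda>x. \<phi> x * f x) \<le> \<mu> \<phi>"
        using f \<phi>(1,2) by (intro poslin_rm_mono[OF Ep_poslin[OF \<mu>(1)]] Cc_mult_continuous[OF c]) (auto intro: mult_left_le)
      then show "ereal (w f) \<le> 1" using f \<phi>(3) by (simp add: w_def density_def)
    qed
    have "\<phi> x * \<theta> x = \<phi> x" for x
      using \<theta>(3) eq_0_outside_tsupp[of x \<phi>] by (cases "x \<in> tsupp \<phi>") auto
    then have "(\<lambda>x. \<phi> x * \<theta> x) = \<phi>" by (rule ext)
    then have "density \<phi> \<mu> \<theta> = \<mu> \<phi>" using \<theta>(1) unfolding density_def by metis
    then have "ereal (w \<theta>) = 1" using \<phi>(3) by (simp add: w_def)
    moreover have "ereal (w \<theta>) \<le> total_mass w"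
      unfolding total_mass_def using \<theta>(1,2) by (intro SUP_upper) simp
    ultimately show "1 \<le> total_mass w" by metis
  qed
  ultimately have "0 < capacity \<kappa> ?K" unfolding capacity_pos_iff Emeas_pos_on_eq by blast
  moreover have "compact ?K" by (rule compact_Int_closed[OF Cc_compact_tsupp[OF \<phi>(1)] assms(1)])
  ultimately show ?thesis by (auto simp: cpt_pos_subsets_def)
qed

lemma compact_approximation:
  assumes "closed F" "\<mu> \<in> Emeas_pos_on \<kappa> F" "0 < e"
  obtains K m where "compact K" "K \<subseteq> F" "m \<in> Emeas_pos_on \<kappa> K" "enorm \<kappa> (\<mu> - m) < e"
proof (cases "compact (UNIV :: 'a set)")
  case True
  then have "compact F" using assms(1) compact_Int_closed by force
  moreover have "\<mu> - \<mu> = (\<lambda>f. 0)" by (simp add: fun_eq_iff)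
  then have "enorm \<kappa> (\<mu> - \<mu>) < e"
    using Q_Ep[OF zero_Ep] mutual_scale_left[OF zero_Ep zero_Ep order_refl] assms(3) by (simp add: enorm_eq)
  ultimately show ?thesis using that[of F \<mu>] assms(2) by blast
next
  case nc: False
  have \<mu>: "\<mu> \<in> Ep" "conc_on \<mu> F" using assms(2) by (auto simp: Emeas_pos_on_eq)
  obtain \<phi> where \<phi>: "\<phi> \<in> Cc" "\<forall>x. 0 \<le> \<phi> x \<and> \<phi> x \<le> 1" "enorm \<kappa> (\<mu> - density \<phi> \<mu>) < e"
    by (rule density_approximation[OF nc \<mu>(1) assms(3)])
  note c = Cc_continuous[OF \<phi>(1)]
  show ?thesis
  proof (rule that[of "tsupp \<phi> \<inter> F" "density \<phi> \<mu>"])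
    show "compact (tsupp \<phi> \<inter> F)" by (rule compact_Int_closed[OF Cc_compact_tsupp[OF \<phi>(1)] assms(1)])
    show "density \<phi> \<mu> \<in> Emeas_pos_on \<kappa> (tsupp \<phi> \<inter> F)"
      using density_Ep(1)[OF nc \<mu>(1) c \<phi>(2)] conc_on_density[OF \<mu>(2) c] by (simp add: Emeas_pos_on_eq)
  qed (use \<phi>(3) in auto)
qed

section \<open>Convergence along the compact subsets\<close>

lemma eventually_K_up:
  "K0 \<in> cpt_pos_subsets \<kappa> F \<Longrightarrow> \<forall>\<^sub>F K in K_up \<kappa> F. K \<in> cpt_pos_subsets \<kappa> F \<and> K0 \<subseteq> K"
  unfolding K_up_def by (rule eventually_INF1) (auto simp: eventually_principal)

text \<open>The projection for \<open>K\<close> competes in the cone of \<open>F\<close>, so its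
  squared distance to the projection for \<open>F\<close> is at most twice its excess over the
  minimum of \<open>Q\<close>. A measure on a compact \<open>K1\<close> inside \<open>K\<close>,
  close to the projection for \<open>F\<close>, makes the excess small.\<close>

lemma proj_compact_converges:
  assumes \<nu>: "\<nu> \<in> Emeas \<kappa>" and F: "closed F" "0 < capacity \<kappa> F"
  shows "((\<lambda>K. enorm \<kappa> (proj \<kappa> K \<nu> - proj \<kappa> F \<nu>)) \<longlongrightarrow> 0) (K_up \<kappa> F)"
proof (rule tendstoI)
  fix e :: real assume e: "0 < e"
  let ?p = "proj \<kappa> F \<nu>"
  note p = proj(1)[OF \<nu>, of F]
  note pE = Emeas_pos_on_Emeas[OF p]
  define r where "r = enorm \<kappa> (\<nu> - ?p)"
  have r: "0 \<le> r" "Q (\<nu> - ?p) = r\<^sup>2"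
    unfolding r_def using enorm_nonneg[OF Emeas_diff[OF \<nu> pE]] enorm_sq[OF Emeas_diff[OF \<nu> pE]] by auto
  \<comment> \<open>Twice the excess of a measure at distance at most \<open>r + d\<close> from
    \<nu>; continuity at 0 allows \<open>d\<close> to be chosen so that this is below the square of
    \<open>e\<close>.\<close>
  have "((\<lambda>d. 2 * (r + d)\<^sup>2 - 2 * r\<^sup>2) \<longlongrightarrow> 2 * (r + 0)\<^sup>2 - 2 * r\<^sup>2) (at_right 0)"
    by (intro tendsto_intros)
  then have "\<forall>\<^sub>F d in at_right 0. 2 * (r + d)\<^sup>2 - 2 * r\<^sup>2 < e\<^sup>2"
    using e by (intro order_tendstoD(2)) auto
  then have "\<forall>\<^sub>F d in at_right 0. 0 < d \<and> 2 * (r + d)\<^sup>2 - 2 * r\<^sup>2 < e\<^sup>2"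
    using eventually_at_right_less[of 0] by eventually_elim simp
  then obtain d where d: "0 < d" "2 * (r + d)\<^sup>2 - 2 * r\<^sup>2 < e\<^sup>2"
    using eventually_happens'[OF trivial_limit_at_right_real] by blast
  obtain K1 m where K1: "compact K1" "K1 \<subseteq> F" "m \<in> Emeas_pos_on \<kappa> K1" "enorm \<kappa> (?p - m) < d"
    by (rule compact_approximation[OF F(1) p d(1)])
  \<comment> \<open>\<open>K1\<close> may have capacity 0. Adjoining a set of positive capacity puts
    the union into the index family of \<open>K_up\<close>.\<close>
  obtain K2 where K2: "K2 \<in> cpt_pos_subsets \<kappa> F" using capacity_pos_compact_subset[OF F] by blast
  have "0 < capacity \<kappa> (K1 \<union> K2)"
    using K2 Emeas_pos_on_mono[of K2 "K1 \<union> K2"] unfolding cpt_pos_subsets_def capacity_pos_iff by blast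
  then have "K1 \<union> K2 \<in> cpt_pos_subsets \<kappa> F" using K1 K2 by (auto simp: cpt_pos_subsets_def)
  from eventually_K_up[OF this] show "\<forall>\<^sub>F K in K_up \<kappa> F. dist (enorm \<kappa> (proj \<kappa> K \<nu> - ?p)) 0 < e"
  proof eventually_elim
    case (elim K)
    let ?q = "proj \<kappa> K \<nu>"
    have K: "K \<subseteq> F" "K1 \<subseteq> K" using elim by (auto simp: cpt_pos_subsets_def)
    have q: "?q \<in> Emeas_pos_on \<kappa> F" using proj(1)[OF \<nu>, of K] Emeas_pos_on_mono[OF K(1)] by blast
    note qE = Emeas_pos_on_Emeas[OF q]
    note mE = Emeas_pos_on_Emeas[OF K1(3)]
    have "Q (\<nu> - ?q) \<le> Q (\<nu> - m)"
      using proj(2)[OF \<nu>] K1(3) Emeas_pos_on_mono[OF K(2)] by blast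
    also have "\<dots> = (enorm \<kappa> (\<nu> - m))\<^sup>2" using enorm_sq[OF Emeas_diff[OF \<nu> mE]] by simp
    also have "enorm \<kappa> (\<nu> - m) \<le> r + d" using enorm_triangle3[OF \<nu> pE mE] K1(4) by (simp add: r_def)
    then have "(enorm \<kappa> (\<nu> - m))\<^sup>2 \<le> (r + d)\<^sup>2"
      using enorm_nonneg[OF Emeas_diff[OF \<nu> mE]] by (intro power_mono)
    finally have "Q (\<nu> - ?q) \<le> (r + d)\<^sup>2" .
    moreover have "Q (?q - ?p) \<le> 2 * Q (\<nu> - ?q) + 2 * Q (\<nu> - ?p) - 4 * Q (\<nu> - ?p)"
      by (rule cone_parallelogram[OF \<nu> q p proj(2)[OF \<nu>]])
    ultimately have "Q (?q - ?p) < e\<^sup>2" using d(2) r(2) by simp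
    then have "enorm \<kappa> (?q - ?p) < e" unfolding enorm_eq using e by (simp add: real_less_lsqrt)
    then show ?case using enorm_nonneg[OF Emeas_diff[OF qE pE]] by (simp add: dist_real_def)
  qed
qed

end

theorem lemma3p6:
  fixes \<kappa> :: "'a::t2_space \<Rightarrow> 'a \<Rightarrow> ereal" and \<nu> :: "'a rmeas" and F :: "'a set"
  assumes "locally_compact_space (euclidean :: 'a topology)"
    and "perfect_kernel \<kappa>"
    and "\<nu> \<in> Emeas \<kappa>"
    and "closed F" and "capacity \<kappa> F > 0"
  shows "strong_tendsto \<kappa> (\<lambda>K. proj \<kappa> K \<nu>) (proj \<kappa> F \<nu>) (K_up \<kappa> F)
       \<and> vague_tendsto (\<lambda>K. proj \<kappa> K \<nu>) (proj \<kappa> F \<nu>) (K_up \<kappa> F)"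
proof -
  interpret perfect_lc_kernel \<kappa> by (unfold_locales) (fact assms)+
  note p = proj(1)[OF assms(3)]
  have pE: "proj \<kappa> K \<nu> \<in> Ep" for K using p[of K] by (simp add: Emeas_pos_on_eq)
  note lim = proj_compact_converges[OF assms(3-5)]
  \<comment> \<open>\<open>strong_imp_vague\<close> concerns filters of measures, as does
    consistency; the family indexed by \<open>K\<close> is therefore pushed forward.\<close>
  have "((\<lambda>\<mu>. \<mu> f) \<longlongrightarrow> proj \<kappa> F \<nu> f) (filtermap (\<lambda>K. proj \<kappa> K \<nu>) (K_up \<kappa> F))" for f
    using pE lim by (intro strong_imp_vague) (simp_all add: eventually_filtermap filterlim_filtermap)
  then show ?thesis
    using lim Ep_Emeas[OF pE] by (simp add: strong_tendsto_def vague_tendsto_def filterlim_filtermap)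
qed

end
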